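(* Let $\mathbb K$ be an algebraically closed field of characteristic $0$. Let $V,V'\subset\mathbb K[\mathbf x]$ be vector spaces connected to $1$, and let $\sigma$ be a linear form on $\langle V\cdot V'\rangle$. Let $U\subset V$ and $U'\subset V'$ be vector subspaces such that $1\in U$, $U^+\subset V$ and $U'^+\subset V'$. Suppose $$\operatorname{rank}H^{V,V'}_\sigma=\operatorname{rank}H^{U,U'}_\sigma=r.$$ Then there is a unique $\tilde\sigma\in\mathbb K[[\mathbf y]]$ which coincides with $\sigma$ on $\langle V\cdot V'\rangle$ and satisfies $\operatorname{rank}H_{\tilde\sigma}=r$. Moreover: - $\tilde\sigma=\sum_{i=1}^{r'}\omega_i(\mathbf y)\mathbf e_{\xi_i}(\mathbf y)$ with $\omega_i\in\mathbb K[\mathbf y]$, $\xi_i\in\mathbb K^n$ and $r=\sum_{i=1}^{r'}\mu(\omega_i)$; - $I_{\tilde\sigma}$ is the ideal generated by $\ker H^{U^+,U'}_\sigma$.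
   Context: $\mathbb K[[\mathbf y]]$ is identified with the dual of $\mathbb K[\mathbf x]$ via $\langle\mathbf y^\alpha\mid\mathbf x^\beta\rangle=\alpha!\,\delta_{\alpha\beta}$. For $p\in\mathbb K[\mathbf x]$, $p\star\sigma$ is defined by $\langle p\star\sigma\mid q\rangle=\langle\sigma\mid pq\rangle$. $H_\sigma:p\mapsto p\star\sigma$ and $I_\sigma=\ker H_\sigma$. $\mathbf e_\xi(\mathbf y)=\exp(\sum_j\xi_jy_j)$. For $\omega\in\mathbb K[\mathbf y]$, $\mu(\omega)$ is the dimension of the span of $\omega$ and all its partial derivatives. For a vector space $V\subset\mathbb K[\mathbf x]$, $V^+=V+x_1V+\dots+x_nV$. The space $V$ is connected to $1$ if there is a finite chain of vector spaces $V_0\subset V_1\subset\dots\subset V_s=V$ with $V_0=\langle1\rangle$ and $V_{l+1}\subset V_l^+$. $\langle V\cdot V'\rangle$ is the span of the products $vv'$ with $v\in V$, $v'\in V'$. For vector spaces $W\subset V$, $W'\subset V'$ and a linear form $\sigma$ on $\langle V\cdot V'\rangle$, the truncated Hankel operator is $H^{W,W'}_\sigma:W\to W'^*$, $p\mapsto(w'\mapsto\langle\sigma\mid pw'\rangle)$. *)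

theory Defs
  imports "HOL-Computational_Algebra.Polynomial" "HOL-Library.Poly_Mapping" "HOL-Library.Function_Algebras"
begin

text \<open>Variables are indexed by a finite type 'v (so n = CARD('v)). Monomials are
 finitely supported exponent vectors. A polynomial in K[x] is a finitely supported
 coefficient function on monomials. A formal power series in K[[y]] is an
 arbitrary coefficient function on monomials (coefficient of y^alpha).\<close>

type_synonym ('v, 'a) mpoly = "('v \<Rightarrow>\<^sub>0 nat) \<Rightarrow>\<^sub>0 'a"
type_synonym ('v, 'a) mseries = "('v \<Rightarrow>\<^sub>0 nat) \<Rightarrow> 'a"

definition pscale :: "'a::comm_ring_1 \<Rightarrow> ('v, 'a) mpoly \<Rightarrow> ('v, 'a) mpoly" where
  "pscale c p = Poly_Mapping.map (\<lambda>x. c * x) p"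

definition fscale :: "'a::comm_ring_1 \<Rightarrow> ('b \<Rightarrow> 'a) \<Rightarrow> ('b \<Rightarrow> 'a)" where
  "fscale c f = (\<lambda>x. c * f x)"

abbreviation pspan :: "('v, 'a::field) mpoly set \<Rightarrow> ('v, 'a) mpoly set" where
  "pspan \<equiv> module.span pscale"

abbreviation psubspace :: "('v, 'a::field) mpoly set \<Rightarrow> bool" where
  "psubspace \<equiv> module.subspace pscale"

definition has_dim :: "('a::field \<Rightarrow> 'b::ab_group_add \<Rightarrow> 'b) \<Rightarrow> 'b set \<Rightarrow> nat \<Rightarrow> bool" where
  "has_dim sc S r \<longleftrightarrow> (\<exists>B. finite B \<and> module.span sc B = module.span sc S) \<and> vector_space.dim sc S = r"

definition Xvar :: "'v \<Rightarrow> ('v, 'a::comm_ring_1) mpoly" where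
  "Xvar i = Poly_Mapping.single (Poly_Mapping.single i 1) 1"

definition plus_space :: "('v::finite, 'a::field) mpoly set \<Rightarrow> ('v, 'a) mpoly set" where
  "plus_space V = pspan (V \<union> (\<Union>i. (\<lambda>p. Xvar i * p) ` V))"

definition connected_to_1 :: "('v::finite, 'a::field) mpoly set \<Rightarrow> bool" where
  "connected_to_1 V \<longleftrightarrow> (\<exists>(Vs :: nat \<Rightarrow> ('v, 'a) mpoly set) s.
      (\<forall>l\<le>s. psubspace (Vs l)) \<and> Vs 0 = pspan {1} \<and> Vs s = V \<and>
      (\<forall>l<s. Vs l \<subseteq> Vs (Suc l) \<and> Vs (Suc l) \<subseteq> plus_space (Vs l)))"

definition prod_space :: "('v, 'a::field) mpoly set \<Rightarrow> ('v, 'a) mpoly set \<Rightarrow> ('v, 'a) mpoly set" where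
  "prod_space V V' = pspan {v * v' | v v'. v \<in> V \<and> v' \<in> V'}"

definition linear_form_on :: "('v, 'a::field) mpoly set \<Rightarrow> (('v, 'a) mpoly \<Rightarrow> 'a) \<Rightarrow> bool" where
  "linear_form_on S \<sigma> \<longleftrightarrow> (\<forall>p\<in>S. \<forall>q\<in>S. \<sigma> (p + q) = \<sigma> p + \<sigma> q) \<and>
                          (\<forall>c. \<forall>p\<in>S. \<sigma> (pscale c p) = c * \<sigma> p)"

definition mfact :: "('v \<Rightarrow>\<^sub>0 nat) \<Rightarrow> 'a::comm_semiring_1" where
  "mfact \<alpha> = (\<Prod>i\<in>Poly_Mapping.keys \<alpha>. of_nat (fact (Poly_Mapping.lookup \<alpha> i)))"

text \<open>the duality <y^a | x^b> = a! delta_ab, extended bilinearly\<close>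
definition pairing :: "('v, 'a::comm_ring_1) mseries \<Rightarrow> ('v, 'a) mpoly \<Rightarrow> 'a" where
  "pairing s p = (\<Sum>\<alpha>\<in>Poly_Mapping.keys p. mfact \<alpha> * s \<alpha> * Poly_Mapping.lookup p \<alpha>)"

text \<open>image of the truncated Hankel operator H^{W,W'}_sigma, elements of W'^*
  represented as functions on polynomials vanishing outside W'\<close>
definition hankel_image :: "('v, 'a::field) mpoly set \<Rightarrow> ('v, 'a) mpoly set \<Rightarrow>
     (('v, 'a) mpoly \<Rightarrow> 'a) \<Rightarrow> (('v, 'a) mpoly \<Rightarrow> 'a) set" where
  "hankel_image W W' \<sigma> = (\<lambda>p. \<lambda>w'. if w' \<in> W' then \<sigma> (p * w') else 0) ` W"

definition trunc_hankel_rank :: "('v, 'a::field) mpoly set \<Rightarrow> ('v, 'a) mpoly set \<Rightarrow>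
     (('v, 'a) mpoly \<Rightarrow> 'a) \<Rightarrow> nat \<Rightarrow> bool" where
  "trunc_hankel_rank W W' \<sigma> r \<longleftrightarrow> has_dim fscale (hankel_image W W' \<sigma>) r"

definition trunc_hankel_kernel :: "('v, 'a::field) mpoly set \<Rightarrow> ('v, 'a) mpoly set \<Rightarrow>
     (('v, 'a) mpoly \<Rightarrow> 'a) \<Rightarrow> ('v, 'a) mpoly set" where
  "trunc_hankel_kernel W W' \<sigma> = {p \<in> W. \<forall>w'\<in>W'. \<sigma> (p * w') = 0}"

text \<open>full Hankel operator H_s : p \<mapsto> p \<star> s, where p \<star> s is represented by the
  linear form q \<mapsto> <s | p q>; rank H_s = r means its image has finite dimension r\<close>
definition hankel_rank :: "('v, 'a::field) mseries \<Rightarrow> nat \<Rightarrow> bool" where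
  "hankel_rank s r \<longleftrightarrow> has_dim fscale ((\<lambda>p. \<lambda>q. pairing s (p * q)) ` UNIV) r"

definition hankel_ker :: "('v, 'a::field) mseries \<Rightarrow> ('v, 'a) mpoly set" where
  "hankel_ker s = {p. \<forall>q. pairing s (p * q) = 0}"

abbreviation ideal_gen :: "('v, 'a::field) mpoly set \<Rightarrow> ('v, 'a) mpoly set" where
  "ideal_gen G \<equiv> module.span (*) G"

text \<open>e_xi(y) = exp(sum xi_j y_j): coefficient of y^alpha is xi^alpha / alpha!\<close>
definition exp_series :: "('v \<Rightarrow> 'a::field) \<Rightarrow> ('v, 'a) mseries" where
  "exp_series \<xi> \<alpha> = (\<Prod>i\<in>Poly_Mapping.keys \<alpha>. \<xi> i ^ Poly_Mapping.lookup \<alpha> i) / mfact \<alpha>"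

definition mdvd :: "('v \<Rightarrow>\<^sub>0 nat) \<Rightarrow> ('v \<Rightarrow>\<^sub>0 nat) \<Rightarrow> bool" where
  "mdvd \<alpha> \<gamma> \<longleftrightarrow> (\<forall>i. Poly_Mapping.lookup \<alpha> i \<le> Poly_Mapping.lookup \<gamma> i)"

definition poly_times_series :: "('v, 'a::comm_ring_1) mpoly \<Rightarrow> ('v, 'a) mseries \<Rightarrow> ('v, 'a) mseries" where
  "poly_times_series \<omega> s \<gamma> =
     (\<Sum>\<alpha>\<in>Poly_Mapping.keys \<omega>. if mdvd \<alpha> \<gamma> then Poly_Mapping.lookup \<omega> \<alpha> * s (\<gamma> - \<alpha>) else 0)"

definition pderiv_var :: "'v \<Rightarrow> ('v, 'a::comm_ring_1) mpoly \<Rightarrow> ('v, 'a) mpoly" where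
  "pderiv_var i p = (\<Sum>\<alpha>\<in>Poly_Mapping.keys p.
      Poly_Mapping.single (\<alpha> - Poly_Mapping.single i 1)
        (of_nat (Poly_Mapping.lookup \<alpha> i) * Poly_Mapping.lookup p \<alpha>))"

definition all_derivs :: "('v, 'a::comm_ring_1) mpoly \<Rightarrow> ('v, 'a) mpoly set" where
  "all_derivs \<omega> = {foldr pderiv_var is \<omega> | is. True}"

definition mu :: "('v, 'a::field) mpoly \<Rightarrow> nat" where
  "mu \<omega> = vector_space.dim pscale (all_derivs \<omega>)"

end

theory Submission
  imports Defs
begin

text \<open>
  Choose a basis \<open>B \<subseteq> U\<close> of preimages of a basis of the image of \<open>H\<^bsup>U,U'\<^esup>\<close> and put
  \<open>E = span B\<close>. As the ranks agree, every \<open>p \<in> V\<close> has a unique representative \<open>\<pi> p \<in> E\<close> modulo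
  the kernel of \<open>H\<^bsup>V,V'\<^esup>\<close>, and the operators \<open>b \<mapsto> \<pi> (x\<^sub>i b)\<close> on \<open>E\<close> commute because \<open>x\<^sub>i\<close> can be
  moved to the test side inside \<open>V'\<close>. They turn \<open>E\<close> into a \<open>K[x]\<close>-module generated by \<open>\<pi> 1\<close>, and
  \<open>p \<mapsto> \<sigma> (p \<cdot> \<pi> 1)\<close> is the extension; connectedness to 1 shows that it agrees with \<open>\<sigma>\<close>, and
  every \<open>p\<close> is congruent to \<open>p \<cdot> \<pi> 1\<close> modulo the ideal of the truncated kernel.

  For the decomposition, induct on the rank. If some \<open>x\<^sub>i\<close> has a minimal polynomial with two
  distinct roots, a Bezout identity splits the series into two of smaller rank whose images are in
  direct sum. Otherwise some power of each \<open>x\<^sub>i - \<xi>\<^sub>i\<close> kills the series, so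
  it is \<open>\<omega> e\<^sub>\<xi>\<close>; since \<open>x\<^sub>i - \<xi>\<^sub>i\<close> acts on \<open>\<omega> e\<^sub>\<xi>\<close> by differentiating \<open>\<omega>\<close>, its rank is \<open>\<mu> \<omega>\<close>.
\<close>

section \<open>Polynomials\<close>

lemma pscale_eq_times: "pscale c p = Poly_Mapping.single 0 c * p"
  by (simp add: pscale_def mult_map_scale_conv_mult)

lemma lookup_pscale [simp]:
  "Poly_Mapping.lookup (pscale c p) \<alpha> = c * Poly_Mapping.lookup p \<alpha>"
  by (simp add: pscale_def map.rep_eq when_def)

lemma pscale_mult_left: "pscale c p * q = pscale c (p * q)"
  by (simp add: pscale_eq_times mult.assoc)

lemma pscale_mult_right: "p * pscale c q = pscale c (p * q)"
  by (simp add: pscale_eq_times mult.left_commute)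

interpretation P: vector_space "pscale :: 'a::field \<Rightarrow> ('v, 'a) mpoly \<Rightarrow> ('v, 'a) mpoly"
  by unfold_locales (auto simp: lookup_add algebra_simps intro!: poly_mapping_eqI)

interpretation F: vector_space "fscale :: 'a::field \<Rightarrow> ('b \<Rightarrow> 'a) \<Rightarrow> ('b \<Rightarrow> 'a)"
  by unfold_locales (auto simp: fscale_def algebra_simps)

interpretation I: module "(*) :: ('v, 'a::field) mpoly \<Rightarrow> ('v, 'a) mpoly \<Rightarrow> ('v, 'a) mpoly"
  by unfold_locales (auto simp: algebra_simps)

\<comment> \<open>as a rewrite rule it is \<open>a * (b * x) = a * b * x\<close>, which loops with \<open>mult.assoc\<close>\<close>
declare I.scale_scale [simp del]

text \<open>Induction on the total degree: a nonzero exponent has a positive coordinate from which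
  one unit can be removed. Statements about monomials thus reduce to multiplication by one
  variable.\<close>

lemma exponent_induct [case_names zero step]:
  fixes \<alpha> :: "'v::finite \<Rightarrow>\<^sub>0 nat"
  assumes zero: "Q 0" and step: "\<And>\<alpha> i. Q \<alpha> \<Longrightarrow> Q (\<alpha> + Poly_Mapping.single i 1)"
  shows "Q \<alpha>"
proof (induction "\<Sum>i\<in>UNIV. Poly_Mapping.lookup \<alpha> i" arbitrary: \<alpha>)
  case 0
  then have "\<alpha> = 0" by (intro poly_mapping_eqI) simp
  then show ?case using zero by simp
next
  case (Suc n)
  then obtain i where i: "Poly_Mapping.lookup \<alpha> i \<noteq> 0"
    by (metis Zero_not_Suc sum.neutral)
  define \<beta> where "\<beta> = \<alpha> - Poly_Mapping.single i 1"
  have \<alpha>: "\<alpha> = \<beta> + Poly_Mapping.single i 1"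
    using i by (intro poly_mapping_eqI) (auto simp: \<beta>_def lookup_add lookup_minus lookup_single when_def)
  have "(\<Sum>j\<in>UNIV. Poly_Mapping.lookup \<alpha> j) = Suc (\<Sum>j\<in>UNIV. Poly_Mapping.lookup \<beta> j)"
    unfolding \<alpha> by (simp add: lookup_add lookup_single when_def sum.distrib)
  then show ?case using Suc \<alpha> step by simp
qed

lemma mpoly_sum_monomials:
  "p = (\<Sum>\<alpha>\<in>Poly_Mapping.keys p. pscale (Poly_Mapping.lookup p \<alpha>) (Poly_Mapping.single \<alpha> 1))"
  by (intro poly_mapping_eqI)
     (auto simp: lookup_sum lookup_single when_def in_keys_iff if_distrib cong: if_cong)

lemma mpoly_monomial_induct [case_names add scale monomial]:
  fixes p :: "('v, 'a::field) mpoly"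
  assumes add: "\<And>p q. Q p \<Longrightarrow> Q q \<Longrightarrow> Q (p + q)"
    and scale: "\<And>c p. Q p \<Longrightarrow> Q (pscale c p)"
    and monomial: "\<And>\<alpha>. Q (Poly_Mapping.single \<alpha> 1)"
  shows "Q p"
proof -
  have zero: "Q 0" using scale[OF monomial, of 0] by simp
  have "Q (\<Sum>\<alpha>\<in>A. pscale (Poly_Mapping.lookup p \<alpha>) (Poly_Mapping.single \<alpha> 1))" if "finite A" for A
    using that by induction (auto intro: zero add scale monomial)
  then show ?thesis by (subst mpoly_sum_monomials) simp
qed

lemma Xvar_times_monomial:
  "Xvar i * Poly_Mapping.single \<alpha> 1 = Poly_Mapping.single (\<alpha> + Poly_Mapping.single i 1) 1"
  by (simp add: Xvar_def mult_single add.commute)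

text \<open>Variables build every monomial from 1, and linear combinations build the rest.
  Properties that are linear in \<open>p\<close> then need a check for a single variable
  only.\<close>

lemma mpoly_induct [case_names one add scale var]:
  fixes p :: "('v::finite, 'a::field) mpoly"
  assumes one: "Q 1"
    and add: "\<And>p q. Q p \<Longrightarrow> Q q \<Longrightarrow> Q (p + q)"
    and scale: "\<And>c p. Q p \<Longrightarrow> Q (pscale c p)"
    and var: "\<And>i p. Q p \<Longrightarrow> Q (Xvar i * p)"
  shows "Q p"
proof (induction p rule: mpoly_monomial_induct)
  case (monomial \<alpha>)
  show ?case
  proof (induction \<alpha> rule: exponent_induct)
    case zero
    show ?case using one by simp
  next
    case (step \<alpha> i)
    then show ?case using var[of "Poly_Mapping.single \<alpha> 1" i] by (simp only: Xvar_times_monomial)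
  qed
qed (auto intro: add scale)

section \<open>The duality pairing\<close>

lemma prod_UNIV_add_single:
  fixes \<alpha> :: "'v::finite \<Rightarrow>\<^sub>0 nat" and g :: "'v \<Rightarrow> nat \<Rightarrow> 'a::comm_monoid_mult"
  assumes "g i (Suc (Poly_Mapping.lookup \<alpha> i)) = c * g i (Poly_Mapping.lookup \<alpha> i)"
  shows "(\<Prod>j\<in>UNIV. g j (Poly_Mapping.lookup (\<alpha> + Poly_Mapping.single i 1) j))
       = c * (\<Prod>j\<in>UNIV. g j (Poly_Mapping.lookup \<alpha> j))"
proof -
  have "(\<Prod>j\<in>UNIV - {i}. g j (Poly_Mapping.lookup (\<alpha> + Poly_Mapping.single i 1) j))
      = (\<Prod>j\<in>UNIV - {i}. g j (Poly_Mapping.lookup \<alpha> j))"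
    by (rule prod.cong) (auto simp: lookup_add lookup_single)
  then show ?thesis
    by (simp add: prod.remove[of UNIV i] lookup_add assms mult.assoc)
qed

text \<open>The index set \<open>keys\<close> changes with the exponent. Since
  \<open>g i 0 = 1\<close>, the product may run over the whole finite type instead, where only the
  factor at \<open>i\<close> changes. Serves both factorials and powers of a point.\<close>

lemma prod_keys_add_single:
  fixes \<alpha> :: "'v::finite \<Rightarrow>\<^sub>0 nat" and g :: "'v \<Rightarrow> nat \<Rightarrow> 'a::comm_monoid_mult"
  assumes "\<And>i. g i 0 = 1"
    and "g i (Suc (Poly_Mapping.lookup \<alpha> i)) = c * g i (Poly_Mapping.lookup \<alpha> i)"
  shows "(\<Prod>j\<in>Poly_Mapping.keys (\<alpha> + Poly_Mapping.single i 1).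
            g j (Poly_Mapping.lookup (\<alpha> + Poly_Mapping.single i 1) j))
       = c * (\<Prod>j\<in>Poly_Mapping.keys \<alpha>. g j (Poly_Mapping.lookup \<alpha> j))"
proof -
  have *: "(\<Prod>j\<in>Poly_Mapping.keys \<beta>. g j (Poly_Mapping.lookup \<beta> j))
      = (\<Prod>j\<in>UNIV. g j (Poly_Mapping.lookup \<beta> j))" for \<beta>
    by (rule prod.mono_neutral_left) (auto simp: in_keys_iff assms(1))
  show ?thesis unfolding * by (rule prod_UNIV_add_single) (rule assms(2))
qed

lemma mfact_zero [simp]: "mfact 0 = 1"
  by (simp add: mfact_def)

lemma mfact_add_single:
  "mfact (\<alpha> + Poly_Mapping.single (i::'v::finite) 1)
    = (of_nat (Suc (Poly_Mapping.lookup \<alpha> i)) * mfact \<alpha> :: 'a::comm_ring_1)"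
  unfolding mfact_def
  by (rule prod_keys_add_single[where g = "\<lambda>_ k. of_nat (fact k)"]) (simp_all add: algebra_simps)

lemma mfact_nonzero [simp]: "mfact \<alpha> \<noteq> (0 :: 'a::field_char_0)"
  by (simp add: mfact_def)

lemma pairing_add: "pairing s (p + q) = pairing s p + pairing s q"
  unfolding pairing_def by (rule setsum_keys_plus_distrib) (auto simp: algebra_simps)

lemma pairing_pscale: "pairing s (pscale c p) = c * pairing s p"
proof -
  have "pairing s (pscale c p) = (\<Sum>\<alpha>\<in>Poly_Mapping.keys p. mfact \<alpha> * s \<alpha> * Poly_Mapping.lookup (pscale c p) \<alpha>)"
    unfolding pairing_def by (rule sum.mono_neutral_left) (auto simp: in_keys_iff)
  also have "\<dots> = c * pairing s p"
    by (simp add: pairing_def sum_distrib_left algebra_simps)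
  finally show ?thesis .
qed

lemma pairing_diff: "pairing s (p - q) = pairing s p - pairing (s :: ('v, 'a::field) mseries) q"
  using pairing_add[of s "p - q" q] by (simp add: algebra_simps)

lemma pairing_zero_right [simp]: "pairing s 0 = 0"
  by (simp add: pairing_def)

lemma pairing_monomial [simp]: "pairing s (Poly_Mapping.single \<alpha> 1) = mfact \<alpha> * s \<alpha>"
  by (simp add: pairing_def)

lemma pairing_series_add: "pairing (\<lambda>\<gamma>. s \<gamma> + t \<gamma>) p = pairing s p + pairing t p"
  by (simp add: pairing_def algebra_simps sum.distrib)

lemma pairing_series_scale: "pairing (\<lambda>\<gamma>. c * s \<gamma>) p = c * pairing s p"
  by (simp add: pairing_def algebra_simps sum_distrib_left)

lemma series_eqI:
  fixes s t :: "('v, 'a::field_char_0) mseries"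
  assumes "\<And>p. pairing s p = pairing t p"
  shows "s = t"
proof
  fix \<alpha>
  show "s \<alpha> = t \<alpha>"
    using assms[of "Poly_Mapping.single \<alpha> 1"] by simp
qed

text \<open>The coefficient at \<alpha> has to be the value of \<open>L\<close> on the monomial
  divided by \<open>mfact \<alpha>\<close>, which is nonzero in characteristic 0. Together with
  \<open>series_eqI\<close> this identifies power series with linear forms on polynomials.\<close>

lemma pairing_surj:
  fixes L :: "('v, 'a::field_char_0) mpoly \<Rightarrow> 'a"
  assumes "\<And>p q. L (p + q) = L p + L q" and "\<And>c p. L (pscale c p) = c * L p"
  shows "\<exists>s. \<forall>p. pairing s p = L p"
proof (intro exI allI)
  fix p
  show "pairing (\<lambda>\<alpha>. L (Poly_Mapping.single \<alpha> 1) / mfact \<alpha>) p = L p"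
    by (induction p rule: mpoly_monomial_induct) (auto simp: pairing_add pairing_pscale assms)
qed

section \<open>Derivatives of series and exponential polynomials\<close>

definition sderiv :: "'v \<Rightarrow> ('v, 'a::comm_ring_1) mseries \<Rightarrow> ('v, 'a) mseries" where
  "sderiv i s \<gamma> = of_nat (Suc (Poly_Mapping.lookup \<gamma> i)) * s (\<gamma> + Poly_Mapping.single i 1)"

text \<open>Multiplication by a variable is the transpose of differentiation: raising the exponent
  at \<open>i\<close> multiplies the factorial by exactly the factor that the derivative
  produces.\<close>

lemma pairing_Xvar_times:
  fixes s :: "('v::finite, 'a::field) mseries"
  shows "pairing s (Xvar i * p) = pairing (sderiv i s) p"
proof (induction p rule: mpoly_monomial_induct)
  case (monomial \<alpha>)
  show ?case
    by (simp only: Xvar_times_monomial pairing_monomial mfact_add_single sderiv_def)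
       (simp add: algebra_simps)
qed (auto simp: distrib_left pairing_add pscale_mult_right pairing_pscale)

text \<open>Subtraction of exponents is truncated, so besides \<gamma> raised at \<open>i\<close>
  also \<gamma> itself may be sent to \<gamma>. This happens only when its \<open>i\<close>-th entry
  is 0, and then the coefficient vanishes.\<close>

lemma lookup_pderiv_var:
  "Poly_Mapping.lookup (pderiv_var i p) \<gamma>
     = of_nat (Suc (Poly_Mapping.lookup \<gamma> i)) * Poly_Mapping.lookup p (\<gamma> + Poly_Mapping.single i 1)"
proof -
  let ?\<delta> = "\<gamma> + Poly_Mapping.single i 1"
  let ?f = "\<lambda>\<alpha>. of_nat (Poly_Mapping.lookup \<alpha> i) * Poly_Mapping.lookup p \<alpha>
              when \<alpha> - Poly_Mapping.single i 1 = \<gamma>"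
  have "?f \<alpha> = 0" if "\<alpha> \<noteq> ?\<delta>" for \<alpha>
  proof (cases "Poly_Mapping.lookup \<alpha> i = 0")
    case False
    then have "\<alpha> - Poly_Mapping.single i 1 + Poly_Mapping.single i 1 = \<alpha>"
      by (intro poly_mapping_eqI) (auto simp: lookup_add lookup_minus lookup_single when_def)
    with that show ?thesis by (auto simp: when_def)
  qed simp
  then have "sum ?f (Poly_Mapping.keys p) = sum ?f {?\<delta>}"
    by (intro sum.mono_neutral_cong) (auto simp: in_keys_iff)
  then show ?thesis
    by (simp add: pderiv_var_def lookup_sum lookup_single lookup_add)
qed

lemma pderiv_var_add: "pderiv_var i (p + q) = pderiv_var i p + pderiv_var i q"
  by (rule poly_mapping_eqI) (simp add: lookup_pderiv_var lookup_add algebra_simps)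

lemma pderiv_var_pscale: "pderiv_var i (pscale c p) = pscale c (pderiv_var i p)"
  by (rule poly_mapping_eqI) (simp add: lookup_pderiv_var algebra_simps)

lemma pderiv_var_monomial:
  "pderiv_var i (Poly_Mapping.single \<alpha> 1)
     = pscale (of_nat (Poly_Mapping.lookup \<alpha> i)) (Poly_Mapping.single (\<alpha> - Poly_Mapping.single i 1) 1)"
  by (simp add: pderiv_var_def pscale_def)

section \<open>Products of a polynomial with a power series\<close>

lemma poly_times_series_add:
  "poly_times_series (p + q) s \<gamma> = poly_times_series p s \<gamma> + poly_times_series q s \<gamma>"
  unfolding poly_times_series_def
  by (rule setsum_keys_plus_distrib[where f = "\<lambda>\<alpha> c. if mdvd \<alpha> \<gamma> then c * s (\<gamma> - \<alpha>) else 0"])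
     (auto simp: algebra_simps)

lemma poly_times_series_pscale:
  "poly_times_series (pscale c p) s \<gamma> = c * poly_times_series p s \<gamma>"
proof -
  have "poly_times_series (pscale c p) s \<gamma> = (\<Sum>\<alpha>\<in>Poly_Mapping.keys p.
      if mdvd \<alpha> \<gamma> then Poly_Mapping.lookup (pscale c p) \<alpha> * s (\<gamma> - \<alpha>) else 0)"
    unfolding poly_times_series_def by (rule sum.mono_neutral_left) (auto simp: in_keys_iff)
  also have "\<dots> = c * poly_times_series p s \<gamma>"
    by (auto simp: poly_times_series_def sum_distrib_left algebra_simps intro!: sum.cong)
  finally show ?thesis .
qed

lemma poly_times_series_monomial:
  "poly_times_series (Poly_Mapping.single \<alpha> 1) s \<gamma> = (if mdvd \<alpha> \<gamma> then s (\<gamma> - \<alpha>) else (0::'a::comm_ring_1))"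
  by (simp add: poly_times_series_def)

lemma poly_times_series_zero [simp]: "poly_times_series 0 s \<gamma> = 0"
  by (simp add: poly_times_series_def)

lemma poly_times_series_scale_right:
  "poly_times_series p (\<lambda>\<gamma>. c * s \<gamma>) \<gamma> = c * poly_times_series p s \<gamma>"
  by (auto simp: poly_times_series_def sum_distrib_left algebra_simps intro!: sum.cong)

text \<open>The Leibniz rule. By linearity \<open>p\<close> is a monomial with exponent \<alpha>;
  each of the three terms is then a single coefficient of \<open>s\<close> or 0, according to
  whether \<alpha> divides \<gamma> and \<gamma> raised at \<open>i\<close>.\<close>

lemma sderiv_poly_times_series:
  fixes p :: "('v, 'a::field) mpoly"
  shows "sderiv i (poly_times_series p s) \<gamma>
     = poly_times_series (pderiv_var i p) s \<gamma> + poly_times_series p (sderiv i s) \<gamma>"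
proof (induction p rule: mpoly_monomial_induct)
  case (add p q)
  then show ?case
    by (simp add: sderiv_def poly_times_series_add pderiv_var_add algebra_simps)
next
  case (scale c p)
  then show ?case
    by (simp add: sderiv_def poly_times_series_pscale pderiv_var_pscale algebra_simps)
next
  case (monomial \<alpha>)
  let ?e = "Poly_Mapping.single i (1::nat)"
  show ?case
  proof (cases "mdvd \<alpha> (\<gamma> + ?e)")
    case True
    then have le: "Poly_Mapping.lookup \<alpha> j \<le> Poly_Mapping.lookup \<gamma> j + (1 when i = j)" for j
      by (simp add: mdvd_def lookup_add lookup_single)
    have 1: "mdvd (\<alpha> - ?e) \<gamma>"
      using le by (auto simp: mdvd_def lookup_minus lookup_single when_def le_diff_conv split: if_splits)
    have 2: "\<gamma> - (\<alpha> - ?e) = \<gamma> + ?e - \<alpha>" if "Poly_Mapping.lookup \<alpha> i \<noteq> 0"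
      using that by (intro poly_mapping_eqI) (auto simp: lookup_minus lookup_single lookup_add when_def)
    show ?thesis
    proof (cases "mdvd \<alpha> \<gamma>")
      case True
      have 3: "\<gamma> - \<alpha> + ?e = \<gamma> + ?e - \<alpha>"
        using True by (intro poly_mapping_eqI) (auto simp: mdvd_def lookup_minus lookup_single lookup_add when_def)
      \<comment> \<open>All three terms involve the same coefficient of \<open>s\<close>, and the
        factors match by \<open>\<gamma>\<^sub>i + 1 = \<alpha>\<^sub>i + (\<gamma>\<^sub>i -
        \<alpha>\<^sub>i + 1)\<close>; with truncated subtraction this requires the
        inequality.\<close>
      have "Poly_Mapping.lookup \<alpha> i \<le> Poly_Mapping.lookup \<gamma> i"
        using True by (simp add: mdvd_def)
      then show ?thesis
        using 1 2 3 True \<open>mdvd \<alpha> (\<gamma> + ?e)\<close>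
        by (cases "Poly_Mapping.lookup \<alpha> i = 0")
           (simp_all add: sderiv_def poly_times_series_monomial pderiv_var_monomial
              poly_times_series_pscale lookup_minus of_nat_diff algebra_simps del: One_nat_def)
    next
      case False
      \<comment> \<open>Divisibility fails only by one unit at \<open>i\<close>. The term with the
        derivative of \<open>s\<close> drops out, and the other two carry the same factor
        \<open>\<alpha>\<^sub>i = \<gamma>\<^sub>i + 1\<close>.\<close>
      then obtain j where "Poly_Mapping.lookup \<alpha> j > Poly_Mapping.lookup \<gamma> j"
        by (auto simp: mdvd_def not_le)
      with le[of j] have "Poly_Mapping.lookup \<alpha> i = Suc (Poly_Mapping.lookup \<gamma> i)"
        by (auto simp: when_def split: if_splits)
      then show ?thesis
        using 1 2 False True
        by (simp add: sderiv_def poly_times_series_monomial pderiv_var_monomial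
              poly_times_series_pscale poly_times_series_add algebra_simps del: One_nat_def)
    qed
  next
    case False
    then have 1: "\<not> mdvd \<alpha> \<gamma>"
      by (auto simp: mdvd_def lookup_add intro: le_trans)
    have "\<not> mdvd (\<alpha> - ?e) \<gamma>" if "Poly_Mapping.lookup \<alpha> i \<noteq> 0"
      using that False
      by (auto simp: mdvd_def lookup_add lookup_minus lookup_single when_def le_diff_conv split: if_splits)
    then show ?thesis
      using False 1
      by (cases "Poly_Mapping.lookup \<alpha> i = 0")
         (simp_all add: sderiv_def poly_times_series_monomial pderiv_var_monomial
            poly_times_series_pscale del: One_nat_def)
  qed
qed

lemma sderiv_exp_series:
  fixes \<xi> :: "'v::finite \<Rightarrow> 'a::field_char_0"
  shows "sderiv i (exp_series \<xi>) \<gamma> = \<xi> i * exp_series \<xi> \<gamma>"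
proof -
  have "(\<Prod>j\<in>Poly_Mapping.keys (\<gamma> + Poly_Mapping.single i 1). \<xi> j ^ Poly_Mapping.lookup (\<gamma> + Poly_Mapping.single i 1) j)
      = \<xi> i * (\<Prod>j\<in>Poly_Mapping.keys \<gamma>. \<xi> j ^ Poly_Mapping.lookup \<gamma> j)"
    by (rule prod_keys_add_single[where g = "\<lambda>j k. \<xi> j ^ k"]) simp_all
  then show ?thesis
    unfolding sderiv_def exp_series_def mfact_add_single
    by (simp add: field_simps del: of_nat_Suc)
qed

abbreviation exp_poly :: "('v, 'a::field) mpoly \<Rightarrow> ('v \<Rightarrow> 'a) \<Rightarrow> ('v, 'a) mseries" where
  "exp_poly \<omega> \<xi> \<equiv> poly_times_series \<omega> (exp_series \<xi>)"

abbreviation Const :: "'a::zero \<Rightarrow> ('v, 'a) mpoly" where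
  "Const c \<equiv> Poly_Mapping.single 0 c"

lemma pairing_exp_poly_Xvar:
  fixes \<xi> :: "'v::finite \<Rightarrow> 'a::field_char_0"
  shows "pairing (exp_poly \<omega> \<xi>) (Xvar i * p)
    = pairing (exp_poly (pderiv_var i \<omega> + pscale (\<xi> i) \<omega>) \<xi>) p"
proof -
  have "sderiv i (exp_poly \<omega> \<xi>) = exp_poly (pderiv_var i \<omega> + pscale (\<xi> i) \<omega>) \<xi>"
    by (rule ext, subst sderiv_poly_times_series)
       (simp add: poly_times_series_add poly_times_series_pscale sderiv_exp_series[abs_def]
          poly_times_series_scale_right)
  then show ?thesis by (simp add: pairing_Xvar_times)
qed

text \<open>The exponential is an eigenvector of the derivation with eigenvalue
  \<open>\<xi> i\<close>. Subtracting the eigenvalue leaves pure differentiation of the polynomial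
  factor, which is the link between Hankel rank and \<open>mu\<close>.\<close>

lemma pairing_exp_poly_shift:
  fixes \<xi> :: "'v::finite \<Rightarrow> 'a::field_char_0"
  shows "pairing (exp_poly \<omega> \<xi>) ((Xvar i - Const (\<xi> i)) * p) = pairing (exp_poly (pderiv_var i \<omega>) \<xi>) p"
proof -
  have "(Xvar i - Const (\<xi> i)) * p = Xvar i * p - pscale (\<xi> i) p"
    by (simp add: pscale_eq_times algebra_simps)
  moreover have "exp_poly (pderiv_var i \<omega> + pscale (\<xi> i) \<omega>) \<xi>
      = (\<lambda>\<gamma>. exp_poly (pderiv_var i \<omega>) \<xi> \<gamma> + \<xi> i * exp_poly \<omega> \<xi> \<gamma>)"
    by (rule ext) (simp add: poly_times_series_add poly_times_series_pscale)
  ultimately show ?thesis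
    by (simp add: pairing_diff pairing_exp_poly_Xvar pairing_pscale pairing_series_add pairing_series_scale)
qed

lemma pairing_exp_poly_one:
  fixes \<xi> :: "'v::finite \<Rightarrow> 'a::field_char_0"
  shows "pairing (exp_poly \<omega> \<xi>) 1 = Poly_Mapping.lookup \<omega> 0"
proof -
  have "mdvd \<alpha> 0 \<longleftrightarrow> \<alpha> = 0" for \<alpha> :: "'v \<Rightarrow>\<^sub>0 nat"
    by (auto simp: mdvd_def intro: poly_mapping_eqI)
  then have "exp_poly \<omega> \<xi> 0 = Poly_Mapping.lookup \<omega> 0"
    by (simp add: poly_times_series_def exp_series_def in_keys_iff if_distrib cong: if_cong)
  then show ?thesis using pairing_monomial[of "exp_poly \<omega> \<xi>" 0] by simp
qed

section \<open>Finite dimension\<close>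

context vector_space
begin

text \<open>The finite spanning set required by \<open>has_dim\<close> bounds all independent sets
  in the span, so a basis chosen inside \<open>S\<close> is finite.\<close>

lemma has_dim_basis:
  assumes "has_dim scale S r"
  obtains B where "finite B" "independent B" "B \<subseteq> S" "span B = span S" "card B = r"
proof -
  obtain T where T: "finite T" "span T = span S" and r: "dim S = r"
    using assms by (auto simp: has_dim_def)
  obtain B where B: "B \<subseteq> S" "independent B" "S \<subseteq> span B" "card B = dim S"
    by (rule basis_exists)
  have "B \<subseteq> span T" using B(1) T(2) span_superset by blast
  then have "finite B" using independent_span_bound[OF T(1) B(2)] by blast
  moreover have "span B = span S" using B(1,3) by (metis span_eq span_superset subset_trans)
  ultimately show ?thesis using that B r by blast
qed

lemma has_dimI:
  assumes "finite B" "independent B" "span B = span S"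
  shows "has_dim scale S (card B)"
  using assms dim_eq_card[of B S] by (auto simp: has_dim_def)

lemma has_dim_subset:
  assumes "has_dim scale S r" "T \<subseteq> span S"
  obtains k where "has_dim scale T k"
proof -
  obtain C where C: "finite C" "span C = span S"
    using assms by (auto simp: has_dim_def)
  obtain B where B: "B \<subseteq> T" "independent B" "T \<subseteq> span B"
    by (rule basis_exists)
  have "B \<subseteq> span C" using B(1) assms(2) C(2) by blast
  then have "finite B" using independent_span_bound[OF C(1) B(2)] by blast
  moreover have "span B = span T" using B(1,3) by (metis span_eq span_superset subset_trans)
  ultimately show ?thesis using that has_dimI B(2) by blast
qed

text \<open>A vector outside \<open>span B\<close> would enlarge \<open>B\<close> to
  \<open>r + 1\<close> independent vectors in a space spanned by \<open>r\<close>.\<close>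

lemma independent_spans_if_card_eq:
  assumes "has_dim scale S r" "B \<subseteq> span S" "independent B" "card B = r"
  shows "span B = span S"
proof -
  obtain C where C: "finite C" "span C = span S" "card C = r"
    using has_dim_basis[OF assms(1)] by metis
  have "finite B" using independent_span_bound[OF C(1) assms(3)] assms(2) C(2) by simp
  have "x \<in> span B" if "x \<in> span S" for x
  proof (rule ccontr)
    assume x: "x \<notin> span B"
    then have "independent (insert x B)" using assms(3) by (rule independent_insertI)
    then have "card (insert x B) \<le> card C"
      using independent_span_bound[OF C(1)] assms(2) C(2) that by simp
    moreover have "x \<notin> B" using x span_base by blast
    ultimately show False using C(3) assms(4) \<open>finite B\<close> by simp
  qed
  moreover have "span B \<subseteq> span S" using assms(2) by (rule span_minimal) (rule subspace_span)
  ultimately show ?thesis by blast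
qed

lemma has_dim_zeroD:
  assumes "has_dim scale S 0"
  shows "S \<subseteq> {0}"
proof -
  obtain B where "finite B" "span B = span S" "card B = 0"
    using has_dim_basis[OF assms] by metis
  then show ?thesis using span_superset[of S] by simp
qed

text \<open>The elements of \<open>A\<close> are added one by one. If the new \<open>a\<close> were
  \<open>x + y\<close> with \<open>x\<close> in the span of the earlier ones and \<open>y\<close> in
  \<open>span B\<close>, then \<open>y = a - x\<close> would lie in both spans and vanish, making
  \<open>a\<close> dependent on the earlier ones.\<close>

lemma independent_Un_disjoint_spans:
  assumes "finite A" "independent A" "independent B" "span A \<inter> span B \<subseteq> {0}"
  shows "independent (A \<union> B) \<and> A \<inter> B = {}"
  using assms
proof (induction A rule: finite_induct)
  case (insert a A)
  have sub: "span A \<subseteq> span (insert a A)" by (rule span_mono) auto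
  have ind: "independent A" "a \<notin> span A"
    using insert.prems(1) insert.hyps by (auto simp: independent_insert split: if_splits)
  have IH: "independent (A \<union> B)" "A \<inter> B = {}"
    using insert.IH ind insert.prems sub by auto
  have "a \<notin> span (A \<union> B)"
  proof
    assume "a \<in> span (A \<union> B)"
    then obtain x y where xy: "a = x + y" "x \<in> span A" "y \<in> span B"
      by (auto simp: span_Un)
    have "y = a - x" using xy by simp
    moreover have "a - x \<in> span (insert a A)"
      using sub xy(2) by (intro span_diff) (auto intro: span_base)
    ultimately have "y = 0" using xy(3) insert.prems(3) by auto
    then show False using xy ind by simp
  qed
  then show ?case
    using IH independent_insertI by (auto intro: span_base)
qed auto

lemma has_dim_direct_sum:
  assumes "subspace S" "subspace T" "S \<inter> T \<subseteq> {0}" "has_dim scale S m" "has_dim scale T n"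
    and R: "R = {x + y | x y. x \<in> S \<and> y \<in> T}"
  shows "has_dim scale R (m + n)"
proof -
  obtain A where A: "finite A" "independent A" "span A = span S" "card A = m"
    using has_dim_basis[OF assms(4)] by metis
  obtain B where B: "finite B" "independent B" "span B = span T" "card B = n"
    using has_dim_basis[OF assms(5)] by metis
  have spans: "span S = S" "span T = T" using assms by auto
  have ind: "independent (A \<union> B)" "A \<inter> B = {}"
    using independent_Un_disjoint_spans[OF A(1,2) B(2)] A B assms(3) spans by auto
  have "span (A \<union> B) = R" using A(3) B(3) spans by (simp add: span_Un R)
  then have "span (A \<union> B) = span R" by (metis span_span)
  then show ?thesis
    using has_dimI[OF _ ind(1)] A B ind(2) by (simp add: card_Un_disjoint)
qed

text \<open>Otherwise arbitrarily long initial segments would be independent. Applied to the powers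
  of a variable, this produces a polynomial relation.\<close>

lemma has_dim_sequence_dependent:
  assumes "has_dim scale S r" "\<And>n::nat. g n \<in> span S"
  shows "\<exists>n. g n \<in> span (g ` {..<n})"
proof (rule ccontr)
  assume "\<not> ?thesis"
  then have *: "g n \<notin> span (g ` {..<n})" for n by simp
  have "independent (g ` {..<n}) \<and> card (g ` {..<n}) = n" for n
  proof (induction n)
    case (Suc n)
    have "g n \<notin> g ` {..<n}" using *[of n] span_base[of "g n" "g ` {..<n}"] by auto
    then show ?case using Suc * by (simp add: lessThan_Suc independent_insertI)
  qed (simp add: independent_empty)
  moreover obtain C where C: "finite C" "span C = span S"
    using assms by (auto simp: has_dim_def)
  moreover have "g ` {..<n} \<subseteq> span C" for n using assms(2) C(2) by auto
  ultimately have "Suc (card C) \<le> card C"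
    using independent_span_bound[OF C(1), of "g ` {..<Suc (card C)}"] by simp
  then show False by simp
qed

end

section \<open>Substituting a variable into a univariate polynomial\<close>

definition eval_var :: "'v \<Rightarrow> 'a::comm_ring_1 poly \<Rightarrow> ('v, 'a) mpoly" where
  "eval_var i f = poly (map_poly Const f) (Xvar i)"

lemma eval_var_0 [simp]: "eval_var i 0 = 0"
  by (simp add: eval_var_def)

lemma eval_var_pCons [simp]: "eval_var i (pCons a f) = Const a + Xvar i * eval_var i f"
  by (simp add: eval_var_def map_poly_pCons)

lemma eval_var_1 [simp]: "eval_var i 1 = 1"
  by (simp add: one_pCons)

lemma eval_var_add: "eval_var i (f + g) = eval_var i f + eval_var i g"
  by (induction f g rule: poly_induct2) (auto simp: algebra_simps single_add)

lemma eval_var_smult: "eval_var i (smult c f) = pscale c (eval_var i f)"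
  by (induction f) (auto simp: algebra_simps pscale_eq_times mult_single)

lemma eval_var_mult: "eval_var i (f * g) = eval_var i f * eval_var i g"
  by (induction f) (auto simp: eval_var_add eval_var_smult pscale_eq_times algebra_simps)

lemma eval_var_power: "eval_var i (f ^ n) = eval_var i f ^ n"
  by (induction n) (auto simp: eval_var_mult)

text \<open>Modulo \<open>t - a\<close> the polynomial \<open>g\<close> is the nonzero constant
  \<open>poly g a\<close>, which settles the exponent 1. Multiplying the relations for
  \<open>n\<close> and for 1 gives the one for \<open>n + 1\<close>: every term except the product
  of the two powers contains \<open>g\<close>.\<close>

lemma bezout_linear_power:
  fixes g :: "'a::field poly"
  assumes "poly g a \<noteq> 0"
  shows "\<exists>u v. u * [:- a, 1:] ^ n + v * g = 1"
proof (induction n)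
  case 0
  show ?case by (rule exI[of _ 1], rule exI[of _ 0]) simp
next
  case (Suc n)
  then obtain u v where uv: "u * [:- a, 1:] ^ n + v * g = 1" by blast
  have "[:- a, 1:] dvd g - [:poly g a:]"
    by (simp flip: poly_eq_0_iff_dvd)
  then obtain h where "g - [:poly g a:] = [:- a, 1:] * h" by (elim dvdE)
  then have "g - [:- a, 1:] * h = [:poly g a:]"
    by (simp add: algebra_simps)
  then have *: "[:inverse (poly g a):] * (g - [:- a, 1:] * h) = 1"
    using assms by (simp only:) (simp add: one_pCons)
  define c d where "c = - ([:inverse (poly g a):] * h)" and "d = [:inverse (poly g a):]"
  have "c * [:- a, 1:] + d * g = d * (g - [:- a, 1:] * h)"
    unfolding c_def d_def by algebra
  then have cd: "c * [:- a, 1:] + d * g = 1" using * d_def by simp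
  have "1 = (u * [:- a, 1:] ^ n + v * g) * (c * [:- a, 1:] + d * g)"
    using uv cd by simp
  also have "\<dots> = (u * c) * [:- a, 1:] ^ Suc n
      + (u * [:- a, 1:] ^ n * d + v * (c * [:- a, 1:] + d * g)) * g"
    by (simp only: power_Suc) algebra
  finally show ?case by metis
qed

section \<open>Decomposition of series of finite Hankel rank\<close>

text \<open>The result is kept as a linear form instead of a series, matching the representation
  used in \<open>hankel_rank\<close>.\<close>

definition star :: "('v, 'a::field) mpoly \<Rightarrow> ('v, 'a) mseries \<Rightarrow> ('v, 'a) mpoly \<Rightarrow> 'a" where
  "star p s q = pairing s (p * q)"

lemma hankel_rank_iff_star: "hankel_rank s r \<longleftrightarrow> has_dim fscale (range (\<lambda>p. star p s)) r"
  by (simp add: hankel_rank_def star_def[abs_def])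

section \<open>Linearity of the Hankel map; its kernel as an ideal\<close>

lemma star_add: "star (p + q) s = star p s + star q s"
  by (rule ext) (simp add: star_def distrib_right pairing_add)

lemma star_pscale: "star (pscale c p) s = fscale c (star p s)"
  by (rule ext) (simp add: star_def pscale_mult_left pairing_pscale fscale_def)

lemma star_zero: "star 0 s = 0"
  by (rule ext) (simp add: star_def)

lemma subspace_range_star: "F.subspace (range (\<lambda>p. star p s))"
proof (rule F.subspaceI)
  show "0 \<in> range (\<lambda>p. star p s)" by (metis star_zero rangeI)
next
  fix x y assume "x \<in> range (\<lambda>p. star p s)" "y \<in> range (\<lambda>p. star p s)"
  then show "x + y \<in> range (\<lambda>p. star p s)" by (auto simp flip: star_add)
next
  fix c x assume "x \<in> range (\<lambda>p. star p s)"
  then show "fscale c x \<in> range (\<lambda>p. star p s)" by (auto simp flip: star_pscale)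
qed

lemma hankel_ker_times: "p \<in> hankel_ker s \<Longrightarrow> q * p \<in> hankel_ker s"
  by (simp add: hankel_ker_def mult.left_commute[of q p] mult.assoc)

lemma hankel_ker_add: "p \<in> hankel_ker s \<Longrightarrow> q \<in> hankel_ker s \<Longrightarrow> p + q \<in> hankel_ker s"
  by (auto simp: hankel_ker_def distrib_right pairing_add)

lemma hankel_ker_pscale: "p \<in> hankel_ker s \<Longrightarrow> pscale c p \<in> hankel_ker s"
  by (simp add: pscale_eq_times hankel_ker_times)

lemma hankel_ker_iff_star: "p \<in> hankel_ker s \<longleftrightarrow> star p s = 0"
  by (auto simp: hankel_ker_def star_def fun_eq_iff)

text \<open>The powers of one variable act on the series within a space of finite dimension, so some
  power is a combination of lower ones.\<close>

lemma finite_hankel_rank_ker_eval_var: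
  fixes \<tau> :: "('v, 'a::field) mseries"
  assumes "hankel_rank \<tau> r"
  shows "\<exists>f. f \<noteq> 0 \<and> eval_var i f \<in> hankel_ker \<tau>"
proof -
  let ?g = "\<lambda>f. star (eval_var i f) \<tau>"
  have "?g (monom 1 n) \<in> F.span (range (\<lambda>p. star p \<tau>))" for n
    by (rule F.span_base) (rule rangeI)
  from F.has_dim_sequence_dependent[OF assms[unfolded hankel_rank_iff_star], of "\<lambda>n. ?g (monom 1 n)", OF this]
  obtain n where n: "?g (monom 1 n) \<in> F.span ((\<lambda>n. ?g (monom 1 n)) ` {..<n})" by blast
  have "\<exists>f. (\<forall>k\<ge>n. coeff f k = 0) \<and> x = ?g f"
    if "x \<in> F.span ((\<lambda>n. ?g (monom 1 n)) ` {..<n})" for x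
    using that
  proof (induction rule: F.span_induct_alt)
    case base
    show ?case by (rule exI[of _ 0]) (simp add: star_zero)
  next
    case (step c x y)
    then obtain k f where "k < n" "x = ?g (monom 1 k)" "\<forall>k\<ge>n. coeff f k = 0" "y = ?g f"
      by auto
    then show ?case
      by (intro exI[of _ "smult c (monom 1 k) + f"])
         (auto simp: eval_var_add eval_var_smult star_add star_pscale)
  qed
  then obtain f where f: "\<forall>k\<ge>n. coeff f k = 0" "?g (monom 1 n) = ?g f"
    using n by blast
  \<comment> \<open>The polynomial \<open>f\<close> has no terms of degree \<open>n\<close> or
    higher, so the relation is monic and hence nontrivial.\<close>
  have "coeff (monom 1 n + smult (- 1) f) n = 1" using f by simp
  then have "monom 1 n + smult (- 1) f \<noteq> 0" by (metis coeff_0 zero_neq_one)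
  moreover have "?g (monom 1 n + smult (- 1) f) = 0"
    unfolding eval_var_add eval_var_smult star_add star_pscale f(2)
    by (simp add: fscale_def fun_eq_iff)
  ultimately show ?thesis by (metis hankel_ker_iff_star)
qed

text \<open>As in the Chinese remainder theorem, the summands are \<open>a * f\<close> and
  \<open>b * g\<close> applied to the series. Their images meet trivially because
  \<open>f * g\<close> kills it. Neither rank is 0, since otherwise the Bezout identity would put
  \<open>f\<close> or \<open>g\<close> into the kernel; so both are smaller than
  \<open>r\<close>.\<close>

lemma hankel_rank_split:
  fixes \<tau> :: "('v, 'a::field_char_0) mseries"
  assumes r: "hankel_rank \<tau> r" and bez: "a * f + b * g = 1" and fg: "f * g \<in> hankel_ker \<tau>"
    and f: "f \<notin> hankel_ker \<tau>" and g: "g \<notin> hankel_ker \<tau>"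
  shows "\<exists>\<tau>\<^sub>1 \<tau>\<^sub>2 r\<^sub>1 r\<^sub>2. \<tau> = (\<lambda>\<gamma>. \<tau>\<^sub>1 \<gamma> + \<tau>\<^sub>2 \<gamma>) \<and> hankel_rank \<tau>\<^sub>1 r\<^sub>1 \<and> hankel_rank \<tau>\<^sub>2 r\<^sub>2 \<and>
           r = r\<^sub>1 + r\<^sub>2 \<and> r\<^sub>1 < r \<and> r\<^sub>2 < r"
proof -
  have fg0: "pairing \<tau> (f * g * q) = 0" for q
    using fg by (simp add: hankel_ker_def)
  obtain \<tau>\<^sub>1 where \<tau>\<^sub>1: "pairing \<tau>\<^sub>1 p = pairing \<tau> (a * f * p)" for p
    using pairing_surj[of "\<lambda>p. pairing \<tau> (a * f * p)"]
    by (auto simp: distrib_left pairing_add pscale_mult_right pairing_pscale)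
  obtain \<tau>\<^sub>2 where \<tau>\<^sub>2: "pairing \<tau>\<^sub>2 p = pairing \<tau> (b * g * p)" for p
    using pairing_surj[of "\<lambda>p. pairing \<tau> (b * g * p)"]
    by (auto simp: distrib_left pairing_add pscale_mult_right pairing_pscale)
  have sum: "pairing \<tau> p = pairing \<tau>\<^sub>1 p + pairing \<tau>\<^sub>2 p" for p
  proof -
    have "p = a * f * p + b * g * p" using bez by (metis distrib_right mult_1)
    then show ?thesis by (metis \<tau>\<^sub>1 \<tau>\<^sub>2 pairing_add)
  qed
  let ?D = "\<lambda>\<tau>. range (\<lambda>p. star p \<tau>)"
  have star1: "star p \<tau>\<^sub>1 = star (a * f * p) \<tau>" and star2: "star p \<tau>\<^sub>2 = star (b * g * p) \<tau>" for p
    by (simp_all add: fun_eq_iff star_def \<tau>\<^sub>1 \<tau>\<^sub>2 mult.assoc)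
  have sub1: "?D \<tau>\<^sub>1 \<subseteq> ?D \<tau>" unfolding star1 by blast
  have sub2: "?D \<tau>\<^sub>2 \<subseteq> ?D \<tau>" unfolding star2 by blast
  obtain r\<^sub>1 where r1: "hankel_rank \<tau>\<^sub>1 r\<^sub>1"
    unfolding hankel_rank_iff_star
    by (rule F.has_dim_subset[OF r[unfolded hankel_rank_iff_star] subset_trans[OF sub1 F.span_superset]])
  obtain r\<^sub>2 where r2: "hankel_rank \<tau>\<^sub>2 r\<^sub>2"
    unfolding hankel_rank_iff_star
    by (rule F.has_dim_subset[OF r[unfolded hankel_rank_iff_star] subset_trans[OF sub2 F.span_superset]])
  have "?D \<tau> = {x + y | x y. x \<in> ?D \<tau>\<^sub>1 \<and> y \<in> ?D \<tau>\<^sub>2}"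
  proof (intro equalityI subsetI)
    fix x assume "x \<in> ?D \<tau>"
    then obtain p where "x = star p \<tau>" by blast
    then have "x = star p \<tau>\<^sub>1 + star p \<tau>\<^sub>2" by (simp add: star_def sum fun_eq_iff)
    then show "x \<in> {x + y | x y. x \<in> ?D \<tau>\<^sub>1 \<and> y \<in> ?D \<tau>\<^sub>2}" by blast
  next
    fix x assume "x \<in> {x + y | x y. x \<in> ?D \<tau>\<^sub>1 \<and> y \<in> ?D \<tau>\<^sub>2}"
    then show "x \<in> ?D \<tau>"
      using sub1 sub2 F.subspace_add[OF subspace_range_star] by blast
  qed
  moreover have "?D \<tau>\<^sub>1 \<inter> ?D \<tau>\<^sub>2 \<subseteq> {0}"
  proof
    fix h assume "h \<in> ?D \<tau>\<^sub>1 \<inter> ?D \<tau>\<^sub>2"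
    then obtain p p' where h1: "h = star (a * f * p) \<tau>" and h2: "h = star (b * g * p') \<tau>"
      unfolding star1 star2 by blast
    \<comment> \<open>Split \<open>q\<close> by the Bezout identity and use on each part the other
      representation of \<open>h\<close>, so that the factor \<open>f * g\<close> appears.\<close>
    have "h q = 0" for q
    proof -
      have "q = a * f * q + b * g * q" using bez by (metis distrib_right mult_1)
      then have "h q = h (a * f * q) + h (b * g * q)"
        unfolding h1 star_def by (metis distrib_left pairing_add)
      moreover have "h (a * f * q) = pairing \<tau> (f * g * (b * p' * a * q))"
        unfolding h2 star_def by (simp add: ac_simps)
      moreover have "h (b * g * q) = pairing \<tau> (f * g * (a * p * b * q))"
        unfolding h1 star_def by (simp add: ac_simps)
      ultimately show ?thesis by (simp add: fg0)
    qed
    then show "h \<in> {0}" by (simp add: fun_eq_iff)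
  qed
  ultimately have "has_dim fscale (?D \<tau>) (r\<^sub>1 + r\<^sub>2)"
    using F.has_dim_direct_sum[OF subspace_range_star subspace_range_star] r1 r2
    unfolding hankel_rank_iff_star by blast
  then have req: "r = r\<^sub>1 + r\<^sub>2" using r by (simp add: hankel_rank_iff_star has_dim_def)
  have "r\<^sub>1 \<noteq> 0"
  proof
    assume "r\<^sub>1 = 0"
    then have "star 1 \<tau>\<^sub>1 = 0" using F.has_dim_zeroD r1 unfolding hankel_rank_iff_star by blast
    then have "a * f \<in> hankel_ker \<tau>" unfolding star1 by (simp add: hankel_ker_iff_star)
    from hankel_ker_add[OF hankel_ker_times[OF this] hankel_ker_times[OF fg]]
    have "f * (a * f) + b * (f * g) \<in> hankel_ker \<tau>" .
    moreover have "f * (a * f) + b * (f * g) = f * (a * f + b * g)" by (simp add: algebra_simps)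
    ultimately show False using f bez by simp
  qed
  moreover have "r\<^sub>2 \<noteq> 0"
  proof
    assume "r\<^sub>2 = 0"
    then have "star 1 \<tau>\<^sub>2 = 0" using F.has_dim_zeroD r2 unfolding hankel_rank_iff_star by blast
    then have "b * g \<in> hankel_ker \<tau>" unfolding star2 by (simp add: hankel_ker_iff_star)
    from hankel_ker_add[OF hankel_ker_times[OF fg] hankel_ker_times[OF this]]
    have "a * (f * g) + g * (b * g) \<in> hankel_ker \<tau>" .
    moreover have "a * (f * g) + g * (b * g) = g * (a * f + b * g)" by (simp add: algebra_simps)
    ultimately show False using g bez by simp
  qed
  moreover have "\<tau> = (\<lambda>\<gamma>. \<tau>\<^sub>1 \<gamma> + \<tau>\<^sub>2 \<gamma>)"
    by (rule series_eqI) (simp add: pairing_series_add sum)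
  ultimately show ?thesis using r1 r2 req by force
qed

text \<open>Consider the minimal polynomial \<open>f\<close> of the variable on the series. With one
  root only, it is a constant times a power of a linear factor. Otherwise that power and its
  cofactor are coprime, and minimality keeps both outside the kernel.\<close>

lemma local_or_split:
  fixes \<tau> :: "('v, 'a::alg_closed_field) mseries"
  assumes "hankel_rank \<tau> r"
  shows "(\<exists>\<xi> N. (Xvar i - Const \<xi>) ^ N \<in> hankel_ker \<tau>) \<or>
    (\<exists>a b f g. a * f + b * g = 1 \<and> f * g \<in> hankel_ker \<tau> \<and> f \<notin> hankel_ker \<tau> \<and> g \<notin> hankel_ker \<tau>)"
proof -
  let ?Q = "\<lambda>f. f \<noteq> 0 \<and> eval_var i f \<in> hankel_ker \<tau>"
  define f where "f = arg_min degree ?Q"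
  have f: "f \<noteq> 0" "eval_var i f \<in> hankel_ker \<tau>"
    using arg_min_natI[of ?Q _ degree] finite_hankel_rank_ker_eval_var[OF assms, of i]
    unfolding f_def by blast+
  have min: "eval_var i g \<notin> hankel_ker \<tau>" if "g \<noteq> 0" "degree g < degree f" for g
    using arg_min_nat_le[of ?Q g degree] that unfolding f_def by fastforce
  have unit: "q \<in> hankel_ker \<tau>" if "q * eval_var i [:c:] \<in> hankel_ker \<tau>" "c \<noteq> 0" for q c
  proof -
    have "pscale (inverse c) (q * eval_var i [:c:]) = q"
      using that by (simp add: pscale_eq_times mult.left_commute[of _ q] mult_single)
    then show ?thesis using hankel_ker_pscale[OF that(1), of "inverse c"] by simp
  qed
  show ?thesis
  proof (cases "degree f = 0")
    case True
    then obtain c where c: "f = [:c:]" by (metis degree_eq_zeroE)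
    \<comment> \<open>A constant minimal polynomial means that the series is zero; the exponent 0
      then witnesses the first alternative.\<close>
    then have "1 \<in> hankel_ker \<tau>" using unit[of 1 c] f by simp
    then show ?thesis by (metis power_0)
  next
    case False
    then obtain \<xi> where \<xi>: "poly f \<xi> = 0"
      using alg_closed_imp_poly_has_root by blast
    let ?N = "order \<xi> f"
    obtain g where fg: "f = [:- \<xi>, 1:] ^ ?N * g" and ndvd: "\<not> [:- \<xi>, 1:] dvd g"
      using order_decomp[OF f(1)] by blast
    have g\<xi>: "poly g \<xi> \<noteq> 0" using ndvd by (simp add: poly_eq_0_iff_dvd)
    have g0: "g \<noteq> 0" using g\<xi> by auto
    have N: "?N > 0" using \<xi> f(1) order_root by blast
    have deg: "degree f = ?N + degree g"
      using g0 by (subst fg) (simp add: degree_mult_eq degree_linear_power)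
    have X: "eval_var i ([:- \<xi>, 1:] ^ ?N) = (Xvar i - Const \<xi>) ^ ?N"
      by (simp add: eval_var_power single_uminus)
    show ?thesis
    proof (cases "degree g = 0")
      case True
      then obtain c where c: "g = [:c:]" by (metis degree_eq_zeroE)
      have "(Xvar i - Const \<xi>) ^ ?N * eval_var i [:c:] \<in> hankel_ker \<tau>"
        using f(2) by (subst (asm) fg) (simp only: eval_var_mult X c)
      moreover have "c \<noteq> 0" using g0 c by auto
      ultimately have "(Xvar i - Const \<xi>) ^ ?N \<in> hankel_ker \<tau>" by (rule unit)
      then show ?thesis by (intro disjI1 exI)
    next
      case False
      obtain u v where "u * [:- \<xi>, 1:] ^ ?N + v * g = 1"
        using bezout_linear_power[OF g\<xi>] by blast
      then have "eval_var i u * eval_var i ([:- \<xi>, 1:] ^ ?N) + eval_var i v * eval_var i g = 1"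
        by (metis eval_var_add eval_var_mult eval_var_1)
      moreover have "eval_var i ([:- \<xi>, 1:] ^ ?N) * eval_var i g \<in> hankel_ker \<tau>"
        using f(2) fg by (metis eval_var_mult)
      moreover have "eval_var i ([:- \<xi>, 1:] ^ ?N) \<notin> hankel_ker \<tau>"
        using False deg by (intro min) (auto simp: degree_linear_power)
      moreover have "eval_var i g \<notin> hankel_ker \<tau>"
        using g0 N deg by (intro min) auto
      ultimately show ?thesis by blast
    qed
  qed
qed

section \<open>The local case: Taylor expansion at one point\<close>

definition shifted_monomial :: "('v::finite \<Rightarrow> 'a::field) \<Rightarrow> ('v \<Rightarrow>\<^sub>0 nat) \<Rightarrow> ('v, 'a) mpoly" where
  "shifted_monomial \<xi> \<alpha> = (\<Prod>j\<in>UNIV. (Xvar j - Const (\<xi> j)) ^ Poly_Mapping.lookup \<alpha> j)"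

lemma shifted_monomial_0 [simp]: "shifted_monomial \<xi> 0 = 1"
  by (simp add: shifted_monomial_def)

lemma shifted_monomial_add_single:
  "shifted_monomial \<xi> (\<alpha> + Poly_Mapping.single i 1) = (Xvar i - Const (\<xi> i)) * shifted_monomial \<xi> \<alpha>"
  unfolding shifted_monomial_def
  by (rule prod_UNIV_add_single[where g = "\<lambda>j k. (Xvar j - Const (\<xi> j)) ^ k"]) simp

text \<open>Each factor differentiates \<omega> once, and the final pairing with 1 evaluates at 0.
  Shifted monomials are thus dual, up to factorials, to the monomials times the exponential, and
  they recover \<omega>.\<close>

lemma pairing_exp_poly_shifted_monomial:
  fixes \<xi> :: "'v::finite \<Rightarrow> 'a::field_char_0"
  shows "pairing (exp_poly \<omega> \<xi>) (shifted_monomial \<xi> \<alpha>) = mfact \<alpha> * Poly_Mapping.lookup \<omega> \<alpha>"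
proof (induction \<alpha> arbitrary: \<omega> rule: exponent_induct)
  case zero
  show ?case by (simp add: pairing_exp_poly_one)
next
  case (step \<alpha> i)
  show ?case
    by (simp only: shifted_monomial_add_single pairing_exp_poly_shift step lookup_pderiv_var
        mfact_add_single) simp
qed

text \<open>Shifted monomials span all polynomials. The induction treats \<open>p\<close> multiplied
  by every shifted monomial, so that a variable, written as its shift plus a constant, is absorbed
  into the exponent.\<close>

lemma pairing_eq_if_shifted_monomials:
  fixes s t :: "('v::finite, 'a::field) mseries"
  assumes "\<And>\<alpha>. pairing s (shifted_monomial \<xi> \<alpha>) = pairing t (shifted_monomial \<xi> \<alpha>)"
  shows "pairing s p = pairing t p"
proof -
  have "\<forall>\<alpha>. pairing s (shifted_monomial \<xi> \<alpha> * p) = pairing t (shifted_monomial \<xi> \<alpha> * p)"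
  proof (induction p rule: mpoly_induct)
    case (var i p)
    have "shifted_monomial \<xi> \<alpha> * (Xvar i * p)
        = shifted_monomial \<xi> (\<alpha> + Poly_Mapping.single i 1) * p + pscale (\<xi> i) (shifted_monomial \<xi> \<alpha> * p)" for \<alpha>
      by (simp only: shifted_monomial_add_single pscale_eq_times) (simp add: algebra_simps)
    then show ?case using var by (simp add: pairing_add pairing_pscale)
  qed (auto simp: assms distrib_left pairing_add pscale_mult_right pairing_pscale)
  from spec[OF this, of 0] show ?thesis by simp
qed

text \<open>Duality forces the coefficients \<open>c\<close> of \<omega>. They vanish as soon as
  some entry of the exponent reaches \<open>N i\<close>, so only finitely many are nonzero.\<close>

lemma exp_poly_if_local:
  fixes \<tau> :: "('v::finite, 'a::field_char_0) mseries"
  assumes "\<And>i. (Xvar i - Const (\<xi> i)) ^ N i \<in> hankel_ker \<tau>"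
  shows "\<exists>\<omega>. \<tau> = exp_poly \<omega> \<xi>"
proof -
  define c where "c \<alpha> = pairing \<tau> (shifted_monomial \<xi> \<alpha>) / mfact \<alpha>" for \<alpha>
  have c0: "Poly_Mapping.lookup \<alpha> i < N i" if "c \<alpha> \<noteq> 0" for \<alpha> i
  proof (rule ccontr)
    assume "\<not> ?thesis"
    then have "(Xvar i - Const (\<xi> i)) ^ N i dvd (Xvar i - Const (\<xi> i)) ^ Poly_Mapping.lookup \<alpha> i"
      by (intro le_imp_power_dvd) simp
    also have "\<dots> dvd shifted_monomial \<xi> \<alpha>"
      unfolding shifted_monomial_def by (rule dvd_prodI) auto
    finally obtain q where "shifted_monomial \<xi> \<alpha> = (Xvar i - Const (\<xi> i)) ^ N i * q"
      by (elim dvdE)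
    then have "pairing \<tau> (shifted_monomial \<xi> \<alpha>) = 0"
      using assms[of i] by (simp add: hankel_ker_def)
    then show False using that by (simp add: c_def)
  qed
  have "finite {\<alpha>. c \<alpha> \<noteq> 0}"
  proof (rule inj_on_finite)
    show "inj_on Poly_Mapping.lookup {\<alpha>. c \<alpha> \<noteq> 0}"
      by (intro inj_onI poly_mapping_eq_iff[THEN iffD2])
    \<comment> \<open>The sum serves as one bound for all coordinates at once.\<close>
    have "Poly_Mapping.lookup \<alpha> i < sum N UNIV" if "c \<alpha> \<noteq> 0" for \<alpha> i
      using c0[OF that, of i] member_le_sum[of i UNIV N] by simp
    then show "Poly_Mapping.lookup ` {\<alpha>. c \<alpha> \<noteq> 0}
        \<subseteq> {h. \<forall>i. (i \<in> UNIV \<longrightarrow> h i \<in> {..<sum N UNIV}) \<and> (i \<notin> UNIV \<longrightarrow> h i = 0)}"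
      by auto
    show "finite {h::'v \<Rightarrow> nat. \<forall>i. (i \<in> UNIV \<longrightarrow> h i \<in> {..<sum N UNIV}) \<and> (i \<notin> UNIV \<longrightarrow> h i = 0)}"
      by (rule finite_set_of_finite_funs) auto
  qed
  then obtain \<omega> where \<omega>: "Poly_Mapping.lookup \<omega> = c"
    using lookup_Abs_poly_mapping by blast
  have "pairing \<tau> p = pairing (exp_poly \<omega> \<xi>) p" for p
  proof (rule pairing_eq_if_shifted_monomials)
    fix \<alpha>
    show "pairing \<tau> (shifted_monomial \<xi> \<alpha>) = pairing (exp_poly \<omega> \<xi>) (shifted_monomial \<xi> \<alpha>)"
      unfolding pairing_exp_poly_shifted_monomial \<omega> c_def by simp
  qed
  then have "\<tau> = exp_poly \<omega> \<xi>" by (rule series_eqI)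
  then show ?thesis by (rule exI)
qed

text \<open>Sending \<eta> to the linear form of \<eta> times the exponential is linear and
  injective, and it maps the span of the derivatives of \<omega> onto the image of the Hankel
  operator.\<close>

lemma hankel_rank_exp_poly:
  fixes \<xi> :: "'v::finite \<Rightarrow> 'a::field_char_0"
  assumes "hankel_rank (exp_poly \<omega> \<xi>) r"
  shows "mu \<omega> = r"
proof -
  let ?\<Phi> = "\<lambda>\<eta>. pairing (exp_poly \<eta> \<xi>)"
  let ?D = "range (\<lambda>p. star p (exp_poly \<omega> \<xi>))"
  have exp_add: "exp_poly (\<eta> + \<zeta>) \<xi> = (\<lambda>\<gamma>. exp_poly \<eta> \<xi> \<gamma> + exp_poly \<zeta> \<xi> \<gamma>)" for \<eta> \<zeta>
    by (rule ext) (rule poly_times_series_add)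
  have exp_scale: "exp_poly (pscale c \<eta>) \<xi> = (\<lambda>\<gamma>. c * exp_poly \<eta> \<xi> \<gamma>)" for c \<eta>
    by (rule ext) (rule poly_times_series_pscale)
  have lin: "Vector_Spaces.linear pscale fscale ?\<Phi>"
    by (auto simp: Vector_Spaces.linear_iff exp_add exp_scale pairing_series_add pairing_series_scale fscale_def fun_eq_iff
        intro: P.vector_space_axioms F.vector_space_axioms)
  interpret \<Phi>: Vector_Spaces.linear pscale fscale ?\<Phi> by (rule lin)
  have "\<eta> = \<zeta>" if "?\<Phi> \<eta> = ?\<Phi> \<zeta>" for \<eta> \<zeta>
  proof (rule poly_mapping_eqI)
    fix \<alpha>
    show "Poly_Mapping.lookup \<eta> \<alpha> = Poly_Mapping.lookup \<zeta> \<alpha>"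
      using fun_cong[OF that, of "shifted_monomial \<xi> \<alpha>"]
      by (simp add: pairing_exp_poly_shifted_monomial)
  qed
  then have inj: "inj ?\<Phi>" by (rule injI)
  have deriv_span: "pderiv_var i \<eta> \<in> P.span (all_derivs \<omega>)" if "\<eta> \<in> P.span (all_derivs \<omega>)" for i \<eta>
    using that
  proof (induction rule: P.span_induct_alt)
    case base
    show ?case by (simp add: pderiv_var_def P.span_zero)
  next
    case (step c x y)
    then obtain "is" where "x = foldr pderiv_var is \<omega>" by (auto simp: all_derivs_def)
    then have "pderiv_var i x = foldr pderiv_var (i # is) \<omega>" by simp
    then have "pderiv_var i x \<in> all_derivs \<omega>" unfolding all_derivs_def by blast
    then show ?case
      using step by (auto simp: pderiv_var_add pderiv_var_pscale intro: P.span_add P.span_scale P.span_base)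
  qed
  \<comment> \<open>A variable acts as differentiation plus a scalar, which preserves the span of
    the derivatives.\<close>
  have "star p (exp_poly \<omega> \<xi>) \<in> ?\<Phi> ` P.span (all_derivs \<omega>)" for p
  proof (induction p rule: mpoly_induct)
    case one
    have "\<omega> = foldr pderiv_var [] \<omega>" by simp
    then have "\<omega> \<in> all_derivs \<omega>" unfolding all_derivs_def by blast
    then show ?case
      by (intro image_eqI[of _ _ \<omega>]) (auto simp: star_def fun_eq_iff intro: P.span_base)
  next
    case (add p q)
    then show ?case unfolding star_add
      by (rule F.subspace_add[OF \<Phi>.subspace_image[OF P.subspace_span]])
  next
    case (scale c p)
    then show ?case unfolding star_pscale
      by (rule F.subspace_scale[OF \<Phi>.subspace_image[OF P.subspace_span]])
  next
    case (var i p)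
    then obtain \<eta> where \<eta>: "\<eta> \<in> P.span (all_derivs \<omega>)" "star p (exp_poly \<omega> \<xi>) = ?\<Phi> \<eta>" by blast
    have "star (Xvar i * p) (exp_poly \<omega> \<xi>) q = ?\<Phi> (pderiv_var i \<eta> + pscale (\<xi> i) \<eta>) q" for q
    proof -
      have "star (Xvar i * p) (exp_poly \<omega> \<xi>) q = star p (exp_poly \<omega> \<xi>) (Xvar i * q)"
        by (simp add: star_def ac_simps)
      then show ?thesis unfolding \<eta>(2) by (simp add: pairing_exp_poly_Xvar)
    qed
    moreover have "pderiv_var i \<eta> + pscale (\<xi> i) \<eta> \<in> P.span (all_derivs \<omega>)"
      using \<eta>(1) deriv_span by (auto intro: P.span_add P.span_scale)
    ultimately show ?case by (intro image_eqI[of _ _ "pderiv_var i \<eta> + pscale (\<xi> i) \<eta>"]) auto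
  qed
  \<comment> \<open>Conversely, every derivative is reached by multiplying with shifted
    variables.\<close>
  moreover have "?\<Phi> (foldr pderiv_var is \<omega>) \<in> ?D" for "is"
  proof (induction "is")
    case Nil
    show ?case by (rule range_eqI[of _ _ 1]) (simp add: star_def fun_eq_iff)
  next
    case (Cons i "is")
    then obtain p where p: "?\<Phi> (foldr pderiv_var is \<omega>) = star p (exp_poly \<omega> \<xi>)" by auto
    have "?\<Phi> (foldr pderiv_var (i # is) \<omega>) q = star ((Xvar i - Const (\<xi> i)) * p) (exp_poly \<omega> \<xi>) q" for q
      using fun_cong[OF p, of "(Xvar i - Const (\<xi> i)) * q"]
      unfolding star_def pairing_exp_poly_shift by (simp add: ac_simps)
    then show ?case by (intro range_eqI ext)
  qed
  then have "?\<Phi> ` all_derivs \<omega> \<subseteq> ?D" by (auto simp: all_derivs_def)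
  then have "?\<Phi> ` P.span (all_derivs \<omega>) \<subseteq> ?D"
    using F.span_minimal[OF _ subspace_range_star] by (metis \<Phi>.span_image)
  ultimately have D: "?D = ?\<Phi> ` P.span (all_derivs \<omega>)" by blast
  obtain C where C: "C \<subseteq> all_derivs \<omega>" "P.independent C" "all_derivs \<omega> \<subseteq> P.span C" "card C = P.dim (all_derivs \<omega>)"
    by (rule P.basis_exists)
  have "P.span C = P.span (all_derivs \<omega>)"
    using C(1,3) by (metis P.span_eq P.span_superset subset_trans)
  then have "F.span (?\<Phi> ` C) = F.span ?D"
    using D by (metis \<Phi>.span_image F.span_span)
  moreover have "F.independent (?\<Phi> ` C)"
    using C(2) inj by (intro \<Phi>.independent_injective_image) (auto intro: inj_on_subset)
  ultimately have "F.dim ?D = card (?\<Phi> ` C)" by (intro F.dim_eq_card)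
  also have "\<dots> = card C" using inj by (intro card_image) (auto intro: inj_on_subset)
  finally show ?thesis
    using assms C(4) by (simp add: mu_def hankel_rank_iff_star has_dim_def)
qed

theorem hankel_rank_decomposition:
  fixes \<tau> :: "('v::finite, 'a::{alg_closed_field, field_char_0}) mseries"
  assumes "hankel_rank \<tau> r"
  shows "\<exists>(r'::nat) \<omega> \<xi>. \<tau> = (\<lambda>\<gamma>. \<Sum>i<r'. exp_poly (\<omega> i) (\<xi> i) \<gamma>) \<and> r = (\<Sum>i<r'. mu (\<omega> i))"
  using assms
proof (induction r arbitrary: \<tau> rule: less_induct)
  case (less r)
  show ?case
  proof (cases "\<exists>a b f g. a * f + b * g = 1 \<and> f * g \<in> hankel_ker \<tau> \<and> f \<notin> hankel_ker \<tau> \<and> g \<notin> hankel_ker \<tau>")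
    case True
    then obtain a b f g where "a * f + b * g = 1" "f * g \<in> hankel_ker \<tau>" "f \<notin> hankel_ker \<tau>"
        "g \<notin> hankel_ker \<tau>" by (elim exE conjE)
    from hankel_rank_split[OF less.prems this]
    obtain \<tau>\<^sub>1 \<tau>\<^sub>2 r\<^sub>1 r\<^sub>2 where \<tau>: "\<tau> = (\<lambda>\<gamma>. \<tau>\<^sub>1 \<gamma> + \<tau>\<^sub>2 \<gamma>)" "hankel_rank \<tau>\<^sub>1 r\<^sub>1" "hankel_rank \<tau>\<^sub>2 r\<^sub>2"
        "r = r\<^sub>1 + r\<^sub>2" "r\<^sub>1 < r" "r\<^sub>2 < r"
      by (elim exE conjE)
    obtain m :: nat and \<omega>\<^sub>1 \<xi>\<^sub>1 where 1: "\<tau>\<^sub>1 = (\<lambda>\<gamma>. \<Sum>i<m. exp_poly (\<omega>\<^sub>1 i) (\<xi>\<^sub>1 i) \<gamma>)" "r\<^sub>1 = (\<Sum>i<m. mu (\<omega>\<^sub>1 i))"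
      using less.IH[OF \<tau>(5,2)] by (elim exE conjE)
    obtain n :: nat and \<omega>\<^sub>2 \<xi>\<^sub>2 where 2: "\<tau>\<^sub>2 = (\<lambda>\<gamma>. \<Sum>i<n. exp_poly (\<omega>\<^sub>2 i) (\<xi>\<^sub>2 i) \<gamma>)" "r\<^sub>2 = (\<Sum>i<n. mu (\<omega>\<^sub>2 i))"
      using less.IH[OF \<tau>(6,3)] by (elim exE conjE)
    define \<omega> where "\<omega> i = (if i < m then \<omega>\<^sub>1 i else \<omega>\<^sub>2 (i - m))" for i
    define \<xi> where "\<xi> i = (if i < m then \<xi>\<^sub>1 i else \<xi>\<^sub>2 (i - m))" for i
    have split: "(\<Sum>i<m + n. h i) = (\<Sum>i<m. h i) + (\<Sum>i<n. h (m + i))" for h :: "nat \<Rightarrow> 'a"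
      by (induction n) (auto simp: add.assoc)
    have split': "(\<Sum>i<m + n. h i) = (\<Sum>i<m. h i) + (\<Sum>i<n. h (m + i))" for h :: "nat \<Rightarrow> nat"
      by (induction n) auto
    show ?thesis
      by (intro exI[of _ "m + n"] exI[of _ \<omega>] exI[of _ \<xi>])
         (auto simp: \<tau>(1,4) 1 2 split split' \<omega>_def \<xi>_def)
  next
    case False
    \<comment> \<open>Without any splitting every variable has a single eigenvalue, and these are
      the coordinates of one point. The zero series falls under this case too.\<close>
    then have "\<forall>i. \<exists>\<xi> N. (Xvar i - Const \<xi>) ^ N \<in> hankel_ker \<tau>"
      using local_or_split[OF less.prems] by blast
    then obtain \<xi> N where "\<And>i. (Xvar i - Const (\<xi> i)) ^ N i \<in> hankel_ker \<tau>" by metis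
    then obtain \<omega> where \<omega>: "\<tau> = exp_poly \<omega> \<xi>" using exp_poly_if_local by blast
    then have "mu \<omega> = r" using hankel_rank_exp_poly less.prems by blast
    then show ?thesis
      using \<omega> by (intro exI[of _ 1] exI[of _ "\<lambda>_. \<omega>"] exI[of _ "\<lambda>_. \<xi>"]) auto
  qed
qed

section \<open>Truncated Hankel operators\<close>

lemma subspace_prod_space: "psubspace (prod_space V V')"
  unfolding prod_space_def by (rule P.subspace_span)

lemma times_in_prod_space: "v \<in> V \<Longrightarrow> v' \<in> V' \<Longrightarrow> v * v' \<in> prod_space V V'"
  unfolding prod_space_def by (rule P.span_base) blast

text \<open>Replaces a form that is controlled only on \<open>S\<close> by a linear form on all
  polynomials, so that later computations need no membership conditions for linearity.\<close>

lemma linear_form_extends: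
  fixes \<sigma> :: "('v, 'a::field) mpoly \<Rightarrow> 'a"
  assumes S: "psubspace S" and \<sigma>: "linear_form_on S \<sigma>"
  obtains L where "\<And>p q. L (p + q) = L p + L q" "\<And>c p. L (pscale c p) = c * L p"
    "\<And>p. p \<in> S \<Longrightarrow> L p = \<sigma> p"
proof -
  interpret K: vector_space "(*) :: 'a \<Rightarrow> 'a \<Rightarrow> 'a"
    by unfold_locales (auto simp: algebra_simps)
  interpret PK: vector_space_pair "pscale :: 'a \<Rightarrow> ('v, 'a) mpoly \<Rightarrow> _" "(*) :: 'a \<Rightarrow> 'a \<Rightarrow> 'a" ..
  obtain B where B: "B \<subseteq> S" "P.independent B" "S \<subseteq> P.span B" "card B = P.dim S"
    by (rule P.basis_exists)
  obtain L where L: "Vector_Spaces.linear pscale (*) L" "\<And>x. x \<in> B \<Longrightarrow> L x = \<sigma> x"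
    using PK.linear_independent_extend[OF B(2), of \<sigma>] by auto
  interpret L: Vector_Spaces.linear pscale "(*)" L by (rule L(1))
  have "p \<in> S \<and> L p = \<sigma> p" if "p \<in> P.span B" for p
    using that
  proof (induction rule: P.span_induct_alt)
    case base
    have "\<sigma> (pscale 0 0) = 0 * \<sigma> 0"
      using \<sigma> P.subspace_0[OF S] unfolding linear_form_on_def by blast
    then show ?case using P.subspace_0[OF S] L.zero by simp
  next
    case (step c x y)
    then have "x \<in> S" "pscale c x \<in> S" using B(1) P.subspace_scale[OF S] by auto
    then show ?case
      using step L(2) \<sigma> P.subspace_add[OF S] by (simp add: L.add L.scale linear_form_on_def)
  qed
  then show ?thesis using that[of L] B(3) L.add L.scale by blast
qed

lemma linear_hankel_map:
  fixes L :: "('v, 'a::field) mpoly \<Rightarrow> 'a"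
  assumes "\<And>p q. L (p + q) = L p + L q" and "\<And>c p. L (pscale c p) = c * L p"
  shows "Vector_Spaces.linear pscale fscale (\<lambda>p. \<lambda>w. if w \<in> T then L (p * w) else 0)"
  by (auto simp: Vector_Spaces.linear_iff assms distrib_right pscale_mult_left fscale_def fun_eq_iff
      intro: P.vector_space_axioms F.vector_space_axioms)

text \<open>\<open>B\<close> consists of preimages of a basis of the image. The Hankel map is
  therefore injective on the span of \<open>B\<close>, which says that \<open>U'\<close> separates
  its elements.\<close>

lemma hankel_image_nondegenerate_basis:
  fixes L :: "('v, 'a::field) mpoly \<Rightarrow> 'a"
  assumes add: "\<And>p q. L (p + q) = L p + L q" and scale: "\<And>c p. L (pscale c p) = c * L p"
    and rank: "trunc_hankel_rank U U' L r"
  obtains B where "finite B" "P.independent B" "B \<subseteq> U" "card B = r"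
    "\<And>b. b \<in> P.span B \<Longrightarrow> (\<And>u'. u' \<in> U' \<Longrightarrow> L (b * u') = 0) \<Longrightarrow> b = 0"
proof -
  let ?h = "\<lambda>p. \<lambda>w. if w \<in> U' then L (p * w) else 0"
  interpret h: Vector_Spaces.linear pscale fscale ?h
    by (rule linear_hankel_map[OF add scale])
  obtain C where C: "finite C" "F.independent C" "C \<subseteq> ?h ` U" "F.span C = F.span (?h ` U)" "card C = r"
    by (rule F.has_dim_basis[OF rank[unfolded trunc_hankel_rank_def hankel_image_def]])
  obtain B where B: "B \<subseteq> U" "inj_on ?h B" "C = ?h ` B"
    using C(3) by (auto simp: subset_image_inj)
  have inj: "inj_on ?h (P.span B)"
    using h.inj_on_span_iff_independent_image[of B] B C(2) by simp
  have "finite B" using C(1) B finite_image_iff by blast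
  moreover have "P.independent B"
  proof
    assume "P.dependent B"
    then obtain b where b: "b \<in> B" "b \<in> P.span (B - {b})" by (auto simp: P.dependent_def)
    then have "?h b \<in> F.span (?h ` (B - {b}))" unfolding h.span_image by (rule_tac imageI)
    also have "?h ` (B - {b}) = C - {?h b}"
      unfolding B(3) using B(2) b(1) by (subst inj_on_image_set_diff[OF B(2)]) auto
    finally show False using C(2) b(1) B(3) unfolding F.dependent_def by blast
  qed
  moreover have "card B = r" using B C(5) card_image by fastforce
  moreover have "b = 0" if "b \<in> P.span B" "\<And>u'. u' \<in> U' \<Longrightarrow> L (b * u') = 0" for b
  proof -
    have "?h b = ?h 0" using that(2) unfolding h.zero by (auto simp: fun_eq_iff)
    then show ?thesis using inj_onD[OF inj _ that(1) P.span_zero] by blast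
  qed
  ultimately show ?thesis using that B(1) by blast
qed

text \<open>By nondegeneracy the span of \<open>B\<close> has an image of dimension
  \<open>r\<close>, hence already the whole image of \<open>W\<close>. Used for the truncated
  operator on \<open>V\<close> and, in the uniqueness proof, for a full Hankel operator.\<close>

lemma hankel_representative:
  fixes L :: "('v, 'a::field) mpoly \<Rightarrow> 'a"
  assumes add: "\<And>p q. L (p + q) = L p + L q" and scale: "\<And>c p. L (pscale c p) = c * L p"
    and rank: "trunc_hankel_rank W T L r"
    and B: "P.independent B" "B \<subseteq> W" "card B = r"
    and nondeg: "\<And>b. b \<in> P.span B \<Longrightarrow> (\<And>t. t \<in> T \<Longrightarrow> L (b * t) = 0) \<Longrightarrow> b = 0"
    and p: "p \<in> W"
  shows "\<exists>b\<in>P.span B. \<forall>t\<in>T. L (b * t) = L (p * t)"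
proof -
  let ?h = "\<lambda>p. \<lambda>w. if w \<in> T then L (p * w) else 0"
  interpret h: Vector_Spaces.linear pscale fscale ?h
    by (rule linear_hankel_map[OF add scale])
  have "b = 0" if "b \<in> P.span B" "?h b = 0" for b
  proof (rule nondeg[OF that(1)])
    fix t assume "t \<in> T"
    then show "L (b * t) = 0" using fun_cong[OF that(2), of t] by simp
  qed
  then have inj: "inj_on ?h (P.span B)"
    using h.inj_on_iff_eq_0[OF P.subspace_span, of B] by blast
  have "card (?h ` B) = r"
    using card_image[OF inj_on_subset[OF inj P.span_superset]] B(3) by simp
  moreover have "?h ` B \<subseteq> F.span (?h ` W)"
    using B(2) by (intro subset_trans[OF image_mono F.span_superset])
  ultimately have "F.span (?h ` B) = F.span (?h ` W)"
    using F.independent_spans_if_card_eq[OF rank[unfolded trunc_hankel_rank_def hankel_image_def] _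
        h.independent_injective_image[OF B(1) inj]] by simp
  then have "?h p \<in> ?h ` P.span B"
    using F.span_base[OF imageI[OF p]] h.span_image[of B] by simp
  then obtain b where b: "b \<in> P.span B" "?h p = ?h b" by blast
  then have "L (b * t) = L (p * t)" if "t \<in> T" for t
    using fun_cong[OF b(2), of t] that by simp
  then show ?thesis using b(1) by blast
qed

text \<open>Climb the chain of spaces. Only \<open>p\<close> is known to lie in \<open>V\<close> in
  the variable step: the product with a variable may leave it, so \<open>Q\<close> has to make sense
  outside \<open>V\<close>.\<close>

lemma connected_to_1_induct [consumes 2, case_names one add scale var]:
  fixes V :: "('v::finite, 'a::field) mpoly set"
  assumes V: "connected_to_1 V" "p \<in> V"
    and one: "Q 1"
    and add: "\<And>p q. Q p \<Longrightarrow> Q q \<Longrightarrow> Q (p + q)"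
    and scale: "\<And>c p. Q p \<Longrightarrow> Q (pscale c p)"
    and var: "\<And>i p. p \<in> V \<Longrightarrow> Q p \<Longrightarrow> Q (Xvar i * p)"
  shows "Q p"
proof -
  obtain Vs s where Vs: "Vs 0 = pspan {1}" "Vs s = V"
      "\<And>l. l < s \<Longrightarrow> Vs l \<subseteq> Vs (Suc l) \<and> Vs (Suc l) \<subseteq> plus_space (Vs l)"
    using V(1) unfolding connected_to_1_def by blast
  have Q0: "Q 0" using scale[OF one, of 0] by simp
  have sub: "Vs l \<subseteq> V" if "l \<le> s" for l
    using that
  proof (induction rule: inc_induct)
    case base
    show ?case using Vs(2) by simp
  next
    case (step l)
    then show ?case using Vs(3)[of l] by blast
  qed
  have "\<forall>p\<in>Vs l. Q p" if "l \<le> s" for l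
    using that
  proof (induction l)
    case 0
    have "Q p" if "p \<in> P.span {1}" for p
      using that by (induction rule: P.span_induct_alt) (auto intro: Q0 one add scale)
    then show ?case using Vs(1) by simp
  next
    case (Suc l)
    have "Q p" if "p \<in> P.span (Vs l \<union> (\<Union>i. (\<lambda>p. Xvar i * p) ` Vs l))" for p
      using that
    proof (induction rule: P.span_induct_alt)
      case (step c x y)
      have "Q x" using step(1) Suc sub[of l] var by auto
      then show ?case using step(2) by (intro add scale)
    qed (rule Q0)
    then show ?case using Vs(3)[of l] Suc.prems by (auto simp: plus_space_def)
  qed
  then show ?thesis using Vs(2) V(2) by blast
qed

lemma one_in_connected_to_1:
  fixes V :: "('v::finite, 'a::field) mpoly set"
  assumes "connected_to_1 V"
  shows "1 \<in> V"
proof -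
  obtain Vs s where Vs: "Vs 0 = pspan {1}" "Vs s = V" "\<And>l. l < s \<Longrightarrow> Vs l \<subseteq> Vs (Suc l)"
    using assms unfolding connected_to_1_def by blast
  have "1 \<in> Vs l" if "l \<le> s" for l
    using that
  proof (induction l)
    case (Suc l)
    then show ?case using Vs(3)[of l] by auto
  qed (simp add: Vs(1) P.span_base)
  then show ?thesis using Vs(2) by blast
qed

section \<open>Commuting operators\<close>

text \<open>The monomial with exponent \<alpha> evaluated at the operators \<open>M i\<close>. The
  variables carry no order, so the composition is a fold, meaningful for commuting
  operators.\<close>

definition monomial_action :: "('v \<Rightarrow> 'b \<Rightarrow> 'b) \<Rightarrow> ('v \<Rightarrow>\<^sub>0 nat) \<Rightarrow> 'b \<Rightarrow> 'b" where
  "monomial_action M \<alpha> b = Finite_Set.fold (\<lambda>i. M i ^^ Poly_Mapping.lookup \<alpha> i) b UNIV"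

lemma comp_fun_commute_funpow:
  assumes "\<And>i j x. M i (M j x) = M j (M i x)"
  shows "comp_fun_commute (\<lambda>i. M i ^^ k i)"
proof
  fix i j
  have 1: "M i ((M j ^^ n) x) = (M j ^^ n) (M i x)" for n x i j
    by (induction n) (auto simp: assms[of i j])
  have "(M i ^^ m) ((M j ^^ n) x) = (M j ^^ n) ((M i ^^ m) x)" for m n x
    by (induction m) (auto simp: 1)
  then show "(M j ^^ k j) \<circ> (M i ^^ k i) = (M i ^^ k i) \<circ> (M j ^^ k j)"
    by (simp add: fun_eq_iff)
qed

lemma monomial_action_0: "monomial_action M (0 :: 'v::finite \<Rightarrow>\<^sub>0 nat) b = b"
proof -
  interpret comp_fun_commute "\<lambda>(i::'v) b. b" by unfold_locales auto
  have "Finite_Set.fold (\<lambda>(i::'v) b. b) b A = b" if "finite A" for A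
    using that by induction auto
  then show ?thesis by (simp add: monomial_action_def id_def)
qed

text \<open>By commutation the variable \<open>i\<close> can be applied last; the fold over the
  other variables does not see the change.\<close>

lemma monomial_action_add_single:
  fixes \<alpha> :: "'v::finite \<Rightarrow>\<^sub>0 nat"
  assumes "\<And>i j x. M i (M j x) = M j (M i x)"
  shows "monomial_action M (\<alpha> + Poly_Mapping.single i 1) b = M i (monomial_action M \<alpha> b)"
proof -
  let ?f = "\<lambda>\<alpha> i. M i ^^ Poly_Mapping.lookup \<alpha> i"
  have comm: "comp_fun_commute (?f \<alpha>)" for \<alpha>
    by (rule comp_fun_commute_funpow) (rule assms)
  have step: "Finite_Set.fold (?f \<alpha>) b UNIV = ?f \<alpha> i (Finite_Set.fold (?f \<alpha>) b (UNIV - {i}))" for \<alpha>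
    using comp_fun_commute_on.fold_insert_remove[OF comm[of \<alpha>, unfolded comp_fun_commute_def']
        subset_UNIV finite_UNIV, where x = i and z = b] by simp
  have "Finite_Set.fold (?f (\<alpha> + Poly_Mapping.single i 1)) b (UNIV - {i})
      = Finite_Set.fold (?f \<alpha>) b (UNIV - {i})"
    by (rule Finite_Set.fold_cong[OF comm[unfolded comp_fun_commute_def'] comm[unfolded comp_fun_commute_def']])
       (auto simp: lookup_add lookup_single)
  then show ?thesis
    unfolding monomial_action_def step[of "\<alpha> + _"] step[of \<alpha>] by (simp add: lookup_add)
qed

section \<open>The flat extension\<close>

text \<open>What the two rank conditions provide, with \<open>L\<close> a total linear form in the
  role of \<sigma>. The map \<pi> enters as a bare choice of representatives; nondegeneracy against
  \<open>U'\<close> makes them unique.\<close>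

locale flat_extension =
  fixes V V' U U' B :: "('v::finite, 'a::field_char_0) mpoly set"
    and L :: "('v, 'a) mpoly \<Rightarrow> 'a"
    and \<pi> :: "('v, 'a) mpoly \<Rightarrow> ('v, 'a) mpoly"
  assumes L_add: "L (p + q) = L p + L q" and L_pscale: "L (pscale c p) = c * L p"
    and subspace_U: "psubspace U"
    and V_connected: "connected_to_1 V" and V'_connected: "connected_to_1 V'"
    and U_V: "U \<subseteq> V" and U'_V': "U' \<subseteq> V'" and one_U: "1 \<in> U"
    and plus_U: "plus_space U \<subseteq> V" and plus_U': "plus_space U' \<subseteq> V'"
    and finite_B: "finite B" and independent_B: "P.independent B" and B_U: "B \<subseteq> U"
    and nondegenerate: "b \<in> P.span B \<Longrightarrow> (\<And>u'. u' \<in> U' \<Longrightarrow> L (b * u') = 0) \<Longrightarrow> b = 0"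
    and \<pi>_in: "p \<in> V \<Longrightarrow> \<pi> p \<in> P.span B"
    and L_\<pi>: "p \<in> V \<Longrightarrow> v' \<in> V' \<Longrightarrow> L (\<pi> p * v') = L (p * v')"
begin

abbreviation "E \<equiv> P.span B"
abbreviation "e \<equiv> \<pi> 1"
abbreviation "J \<equiv> ideal_gen (trunc_hankel_kernel (plus_space U) U' L)"

section \<open>Representatives in \<open>E\<close> and the multiplication operators\<close>

lemma L_diff: "L (p - q) = L p - L q"
  using L_add[of "p - q" q] by simp

lemma E_U: "E \<subseteq> U"
  by (rule P.span_minimal[OF B_U subspace_U])

lemma E_V: "b \<in> E \<Longrightarrow> b \<in> V"
  using E_U U_V by blast

lemma e_in: "e \<in> E"
  using \<pi>_in one_U U_V by blast

lemma Xvar_U: "u \<in> U \<Longrightarrow> Xvar i * u \<in> plus_space U"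
  unfolding plus_space_def by (rule P.span_base) blast

lemma Xvar_E: "b \<in> E \<Longrightarrow> Xvar i * b \<in> V"
  using E_U Xvar_U plus_U by blast

lemma Xvar_U': "u' \<in> U' \<Longrightarrow> Xvar i * u' \<in> V'"
proof -
  assume "u' \<in> U'"
  then have "Xvar i * u' \<in> plus_space U'" unfolding plus_space_def by (intro P.span_base) blast
  then show ?thesis using plus_U' by blast
qed

lemma E_eqI:
  assumes "b \<in> E" "c \<in> E" "\<And>u'. u' \<in> U' \<Longrightarrow> L (b * u') = L (c * u')"
  shows "b = c"
proof -
  have "b - c = 0"
    using assms by (intro nondegenerate P.span_diff) (auto simp: left_diff_distrib L_diff)
  then show ?thesis by simp
qed

lemma \<pi>_eqI:
  assumes "p \<in> V" "b \<in> E" "\<And>u'. u' \<in> U' \<Longrightarrow> L (b * u') = L (p * u')"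
  shows "\<pi> p = b"
  using assms \<pi>_in L_\<pi> U'_V' by (intro E_eqI) auto

lemma \<pi>_E: "b \<in> E \<Longrightarrow> \<pi> b = b"
  by (rule \<pi>_eqI) (auto intro: E_V)

text \<open>The operators are set to zero outside \<open>E\<close> so that they commute everywhere.\<close>

definition M :: "'v \<Rightarrow> ('v, 'a) mpoly \<Rightarrow> ('v, 'a) mpoly" where
  "M i b = (if b \<in> E then \<pi> (Xvar i * b) else 0)"

lemma M_in: "M i b \<in> E"
  using \<pi>_in Xvar_E by (auto simp: M_def P.span_zero)

lemma L_M: "b \<in> E \<Longrightarrow> v' \<in> V' \<Longrightarrow> L (M i b * v') = L (Xvar i * b * v')"
  using L_\<pi> Xvar_E by (auto simp: M_def)

lemma L_M_U': "b \<in> E \<Longrightarrow> u' \<in> U' \<Longrightarrow> L (M i b * u') = L (b * (Xvar i * u'))"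
  using L_M[of b u' i] U'_V' by (auto simp: ac_simps)

lemma M_add: "b \<in> E \<Longrightarrow> c \<in> E \<Longrightarrow> M i (b + c) = M i b + M i c"
  by (rule E_eqI) (auto simp: M_in P.span_add L_M_U' distrib_right L_add)

lemma M_pscale: "b \<in> E \<Longrightarrow> M i (pscale k b) = pscale k (M i b)"
  by (rule E_eqI) (auto simp: M_in P.span_scale L_M_U' pscale_mult_left L_pscale)

lemma M_0: "M i 0 = 0"
  using M_pscale[OF P.span_zero, of i 0] by simp

text \<open>Tested against \<open>u'\<close>, the outer operator passes its variable to
  \<open>u'\<close>. The product stays in \<open>V'\<close>, where the inner operator can be
  evaluated, and the resulting expression is symmetric in the two variables.\<close>

lemma M_commute: "M i (M j b) = M j (M i b)"
proof (cases "b \<in> E")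
  case True
  have "L (M i (M j b) * u') = L (Xvar j * b * (Xvar i * u'))" if "u' \<in> U'" for i j u'
    using L_M_U'[OF M_in that] L_M[OF True Xvar_U'[OF that]] by simp
  then show ?thesis
    by (intro E_eqI M_in) (simp add: ac_simps)
qed (simp add: M_def[of _ b] M_0)

section \<open>The polynomial module structure on \<open>E\<close> given by the commuting
  operators\<close>

definition act :: "('v, 'a) mpoly \<Rightarrow> ('v, 'a) mpoly \<Rightarrow> ('v, 'a) mpoly" where
  "act p b = (\<Sum>\<alpha>\<in>Poly_Mapping.keys p. pscale (Poly_Mapping.lookup p \<alpha>) (monomial_action M \<alpha> b))"

lemma act_add: "act (p + q) b = act p b + act q b"
  unfolding act_def
  by (rule setsum_keys_plus_distrib[where f = "\<lambda>\<alpha> c. pscale c (monomial_action M \<alpha> b)"])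
     (auto simp: P.scale_left_distrib)

lemma act_pscale: "act (pscale c p) b = pscale c (act p b)"
proof -
  have "act (pscale c p) b = (\<Sum>\<alpha>\<in>Poly_Mapping.keys p.
      pscale (Poly_Mapping.lookup (pscale c p) \<alpha>) (monomial_action M \<alpha> b))"
    unfolding act_def by (rule sum.mono_neutral_left) (auto simp: in_keys_iff)
  then show ?thesis by (simp add: act_def P.scale_sum_right)
qed

lemma act_monomial: "act (Poly_Mapping.single \<alpha> 1) b = monomial_action M \<alpha> b"
  by (simp add: act_def)

lemma act_1: "act 1 b = b"
  using act_monomial[of 0 b] by (simp add: monomial_action_0)

lemma act_in: "b \<in> E \<Longrightarrow> act p b \<in> E"
proof (induction p rule: mpoly_monomial_induct)
  case (monomial \<alpha>)
  then show ?case
    unfolding act_monomial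
    by (induction \<alpha> rule: exponent_induct)
       (simp_all only: monomial_action_0 monomial_action_add_single[where M = M, OF M_commute] M_in)
qed (auto simp: act_add act_pscale P.span_add P.span_scale)

lemma act_Xvar: "b \<in> E \<Longrightarrow> act (Xvar i * p) b = M i (act p b)"
proof (induction p rule: mpoly_monomial_induct)
  case (monomial \<alpha>)
  show ?case
    by (simp only: Xvar_times_monomial act_monomial monomial_action_add_single[where M = M, OF M_commute])
qed (auto simp: distrib_left act_add pscale_mult_right act_pscale M_add M_pscale act_in)

lemma act_mult: "b \<in> E \<Longrightarrow> act (p * q) b = act p (act q b)"
  by (induction p rule: mpoly_induct)
     (auto simp: act_1 distrib_right act_add pscale_mult_left act_pscale mult.assoc act_Xvar act_in)

lemma act_Xvar': "b \<in> E \<Longrightarrow> act (Xvar i * p) b = act p (M i b)"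
  using act_mult[of b p "Xvar i"] act_Xvar[of b i 1] by (simp add: act_1 mult.commute)

lemma act_0: "act p 0 = 0"
  by (induction p rule: mpoly_induct)
     (auto simp: act_1 act_add act_pscale act_Xvar P.span_zero M_0)

text \<open>The induction is on equality tested against \<open>U'\<close>, since \<pi> is controlled
  only on \<open>V\<close> and the chain argument passes through products outside
  \<open>V\<close>.\<close>

lemma act_e_V: "p \<in> V \<Longrightarrow> act p e = \<pi> p"
proof -
  assume p: "p \<in> V"
  have eq: "\<pi> p = act p e" if "p \<in> V" "\<forall>u'\<in>U'. L (act p e * u') = L (p * u')" for p
    using that by (intro \<pi>_eqI act_in e_in) auto
  have "\<forall>u'\<in>U'. L (act p e * u') = L (p * u')"
    using V_connected p
  proof (induction rule: connected_to_1_induct)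
    case one
    show ?case using L_\<pi>[of 1] one_U U_V U'_V' by (auto simp: act_1)
  next
    case (var i p)
    have "L (act (Xvar i * p) e * u') = L (Xvar i * p * u')" if u': "u' \<in> U'" for u'
    proof -
      \<comment> \<open>As \<open>p\<close> lies in \<open>V\<close>, the hypothesis turns
        \<open>act p e\<close> into \<open>\<pi> p\<close>, which represents \<open>p\<close>
        against all of \<open>V'\<close> and in particular against
        \<open>Xvar i * u'\<close>.\<close>
      have "L (act (Xvar i * p) e * u') = L (\<pi> p * (Xvar i * u'))"
        using u' by (simp add: act_Xvar e_in L_M_U' act_in eq[OF var])
      also have "\<dots> = L (p * (Xvar i * u'))" by (rule L_\<pi>[OF var(1) Xvar_U'[OF u']])
      finally show ?thesis by (simp add: ac_simps)
    qed
    then show ?case by blast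
  qed (auto simp: act_add distrib_right L_add act_pscale pscale_mult_left L_pscale)
  with p show ?thesis using eq by simp
qed

text \<open>The variables of \<open>v'\<close> are handed to \<open>b\<close> one at a time. Each
  transfer replaces \<open>b\<close> by \<open>M i b\<close>, so the induction quantifies over all
  of \<open>E\<close>.\<close>

lemma L_act_V': "v' \<in> V' \<Longrightarrow> b \<in> E \<Longrightarrow> L (act v' b) = L (b * v')"
proof -
  assume v': "v' \<in> V'" and b: "b \<in> E"
  have "\<forall>b\<in>E. L (act v' b) = L (b * v')"
    using V'_connected v'
  proof (induction rule: connected_to_1_induct)
    case (var i p)
    show ?case
    proof
      fix b assume b: "b \<in> E"
      have "L (act (Xvar i * p) b) = L (Xvar i * b * p)"
        using var b by (simp add: act_Xvar' M_in L_M)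
      then show "L (act (Xvar i * p) b) = L (b * (Xvar i * p))" by (simp add: ac_simps)
    qed
  qed (auto simp: act_1 act_add distrib_left L_add act_pscale pscale_mult_right L_pscale)
  then show ?thesis using b by blast
qed

text \<open>For a product, \<open>v\<close> carries \<open>e\<close> to \<open>\<pi> v\<close>, the
  factor \<open>v'\<close> comes out of the action under \<open>L\<close>, and against
  \<open>v'\<close> the representative may be replaced by \<open>v\<close>.\<close>

lemma L_act_prod_space: "p \<in> prod_space V V' \<Longrightarrow> L (act p e) = L p"
  unfolding prod_space_def
proof (induction rule: P.span_induct_alt)
  case base
  show ?case by (simp add: act_def)
next
  case (step c x y)
  then obtain v v' where x: "x = v * v'" and v: "v \<in> V" "v' \<in> V'" by blast
  have "L (act x e) = L (act v' (act v e))"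
    unfolding x by (simp add: mult.commute[of v] act_mult e_in)
  also have "\<dots> = L x"
    using v by (simp add: x act_e_V L_act_V' \<pi>_in L_\<pi>)
  finally show ?case using step by (simp add: act_add act_pscale L_add L_pscale)
qed

section \<open>Reduction modulo the ideal \<open>J\<close>\<close>

lemma generator_kernel:
  assumes "u \<in> plus_space U" "b \<in> E" "\<And>u'. u' \<in> U' \<Longrightarrow> L (b * u') = L (u * u')"
  shows "u - b \<in> J"
proof (rule I.span_base)
  have "U \<subseteq> plus_space U" unfolding plus_space_def by (auto intro: P.span_base)
  then have "u - b \<in> plus_space U"
    using assms(1,2) E_U unfolding plus_space_def by (intro P.span_diff) auto
  then show "u - b \<in> trunc_hankel_kernel (plus_space U) U' L"
    using assms(3) by (simp add: trunc_hankel_kernel_def left_diff_distrib L_diff)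
qed

text \<open>Multiply by one variable at a time. Replacing \<open>Xvar i * c\<close> by
  \<open>M i c\<close> for \<open>c\<close> in \<open>E\<close> costs an element of the truncated
  kernel, since the product lies in \<open>plus_space U\<close>.\<close>

lemma times_minus_act: "b \<in> E \<Longrightarrow> p * b - act p b \<in> J"
proof (induction p rule: mpoly_induct)
  case one
  show ?case by (simp add: act_1 I.span_zero)
next
  case (add p q)
  have "(p + q) * b - act (p + q) b = (p * b - act p b) + (q * b - act q b)"
    by (simp add: act_add algebra_simps)
  then show ?case using add I.span_add by metis
next
  case (scale c p)
  have "pscale c p * b - act (pscale c p) b = Const c * (p * b - act p b)"
    unfolding act_pscale by (simp add: pscale_eq_times algebra_simps)
  then show ?case using scale I.span_scale by metis
next
  case (var i p)
  let ?c = "act p b"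
  have c: "?c \<in> E" using var.prems by (rule act_in)
  have "Xvar i * p * b - act (Xvar i * p) b = Xvar i * (p * b - ?c) + (Xvar i * ?c - M i ?c)"
    unfolding act_Xvar[OF var.prems] by (simp add: algebra_simps)
  moreover have "Xvar i * ?c - M i ?c \<in> J"
    using c E_U U'_V' by (intro generator_kernel) (auto simp: Xvar_U M_in L_M)
  ultimately show ?case using var I.span_scale I.span_add by metis
qed

lemma minus_act_e: "p - act p e \<in> J"
proof -
  have "1 - e \<in> J"
  proof (rule generator_kernel)
    show "1 \<in> plus_space U" using one_U unfolding plus_space_def by (auto intro: P.span_base)
    show "L (e * u') = L (1 * u')" if "u' \<in> U'" for u'
      using L_\<pi>[of 1 u'] that one_U U_V U'_V' by auto
  qed (rule e_in)
  then have "p * (1 - e) + (p * e - act p e) \<in> J"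
    using times_minus_act[OF e_in] by (intro I.span_add I.span_scale)
  then show ?thesis by (simp add: algebra_simps)
qed

text \<open>Generators lie in \<open>V\<close> and are orthogonal to \<open>U'\<close>, so \<pi>
  sends them to 0 and they annihilate \<open>e\<close>. Conversely \<open>p\<close> is congruent to
  \<open>act p e\<close> modulo \<open>J\<close>.\<close>

lemma ideal_gen_eq: "J = {p. act p e = 0}"
proof (intro equalityI subsetI)
  fix p assume "p \<in> J"
  then have "act p e = 0"
  proof (induction rule: I.span_induct_alt)
    case base
    show ?case by (simp add: act_def)
  next
    case (step c x y)
    then have "x \<in> V" "\<forall>u'\<in>U'. L (x * u') = 0"
      using plus_U by (auto simp: trunc_hankel_kernel_def)
    then have "act x e = 0"
      by (subst act_e_V) (auto intro!: \<pi>_eqI simp: P.span_zero L_diff[of 0 0, simplified])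
    then show ?case using step by (simp add: act_add act_mult e_in act_0)
  qed
  then show "p \<in> {p. act p e = 0}" by simp
next
  fix p assume "p \<in> {p. act p e = 0}"
  then show "p \<in> J" using minus_act_e[of p] by simp
qed

text \<open>Testing with \<open>q\<close> in \<open>U'\<close> shows that a kernel element
  annihilates \<open>e\<close>. For the rank, \<open>E\<close> maps injectively to the Hankel image
  because \<open>act b e = b\<close> on \<open>E\<close>, and onto it because every \<open>p\<close>
  is congruent to \<open>act p e\<close> modulo the kernel.\<close>

lemma extension:
  assumes \<tau>: "\<And>p. pairing \<tau> p = L (act p e)"
  shows "hankel_ker \<tau> = J" and "hankel_rank \<tau> (card B)"
proof -
  have pair: "pairing \<tau> (p * q) = L (act q (act p e))" for p q
    unfolding \<tau> mult.commute[of p] by (simp add: act_mult e_in)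
  show ker: "hankel_ker \<tau> = J"
    unfolding ideal_gen_eq hankel_ker_def
  proof (intro Collect_cong iffI allI)
    fix p q assume "act p e = 0"
    then show "pairing \<tau> (p * q) = 0"
      using L_diff[of 0 0] by (simp add: pair act_0)
  next
    fix p assume "\<forall>q. pairing \<tau> (p * q) = 0"
    then have "L (act p e * u') = 0" if "u' \<in> U'" for u'
      using L_act_V'[of u' "act p e"] that U'_V' by (auto simp: pair act_in e_in)
    then show "act p e = 0" by (intro nondegenerate act_in e_in)
  qed
  have "Vector_Spaces.linear pscale fscale (\<lambda>p. star p \<tau>)"
    by (auto simp: Vector_Spaces.linear_iff star_add star_pscale
        intro: P.vector_space_axioms F.vector_space_axioms)
  then interpret s: Vector_Spaces.linear pscale fscale "\<lambda>p. star p \<tau>" .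
  have "b = 0" if "b \<in> E" "star b \<tau> = 0" for b
  proof -
    have "act b e = 0" using that(2) ker by (auto simp: ideal_gen_eq simp flip: hankel_ker_iff_star)
    then show ?thesis using that(1) by (simp add: act_e_V E_V \<pi>_E)
  qed
  then have inj: "inj_on (\<lambda>p. star p \<tau>) E"
    using s.inj_on_iff_eq_0[OF P.subspace_span, of B] by blast
  have "star p \<tau> \<in> (\<lambda>p. star p \<tau>) ` E" for p
  proof -
    have "star (p - act p e) \<tau> = 0"
      using minus_act_e[of p] by (simp add: ker flip: hankel_ker_iff_star)
    then have "star p \<tau> = star (act p e) \<tau>" by (simp add: s.diff)
    then show ?thesis using act_in[OF e_in] by blast
  qed
  then have "F.span ((\<lambda>p. star p \<tau>) ` B) = range (\<lambda>p. star p \<tau>)"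
    unfolding s.span_image by blast
  then have "F.span ((\<lambda>p. star p \<tau>) ` B) = F.span (range (\<lambda>p. star p \<tau>))"
    by (metis F.span_span)
  then have "hankel_rank \<tau> (card ((\<lambda>p. star p \<tau>) ` B))"
    unfolding hankel_rank_iff_star
    using finite_B s.independent_injective_image[OF independent_B inj] by (intro F.has_dimI) auto
  moreover have "card ((\<lambda>p. star p \<tau>) ` B) = card B"
    by (rule card_image[OF inj_on_subset[OF inj P.span_superset]])
  ultimately show "hankel_rank \<tau> (card B)" by simp
qed

text \<open>Equality of ranks gives representatives in \<open>E\<close> for the full operator of
  \<tau>. The one of a truncated kernel element is orthogonal to \<open>U'\<close>, hence 0, so
  \<open>J\<close> lies in the kernel of \<tau>. Thus \<tau> takes the same value on
  \<open>p\<close> and on \<open>act p e\<close>, where it is prescribed.\<close>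

lemma extension_unique:
  assumes \<tau>: "\<And>p. p \<in> prod_space V V' \<Longrightarrow> pairing \<tau> p = L p" and rank: "hankel_rank \<tau> (card B)"
  shows "pairing \<tau> p = L (act p e)"
proof -
  have EU': "pairing \<tau> (b * u') = L (b * u')" if "b \<in> V" "u' \<in> U'" for b u'
    using that U'_V' by (intro \<tau> times_in_prod_space) auto
  have rank': "trunc_hankel_rank UNIV UNIV (pairing \<tau>) (card B)"
    using rank by (simp add: trunc_hankel_rank_def hankel_image_def hankel_rank_def)
  have nondeg': "b = 0" if "b \<in> E" "\<And>t. t \<in> UNIV \<Longrightarrow> pairing \<tau> (b * t) = 0" for b
    using that EU' E_V by (intro nondegenerate) (metis UNIV_I)+
  have rep: "\<exists>b\<in>E. \<forall>q\<in>UNIV. pairing \<tau> (b * q) = pairing \<tau> (p * q)" for p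
    by (rule hankel_representative[OF pairing_add pairing_pscale rank' independent_B subset_UNIV refl nondeg' UNIV_I])
  have "trunc_hankel_kernel (plus_space U) U' L \<subseteq> hankel_ker \<tau>"
  proof
    fix k assume k: "k \<in> trunc_hankel_kernel (plus_space U) U' L"
    then have kV: "k \<in> V" using plus_U by (auto simp: trunc_hankel_kernel_def)
    obtain b where b: "b \<in> E" "\<And>q. pairing \<tau> (b * q) = pairing \<tau> (k * q)" using rep by blast
    have "b = 0"
    proof (rule nondegenerate[OF b(1)])
      fix u' assume u': "u' \<in> U'"
      have "L (b * u') = pairing \<tau> (b * u')" using EU'[OF E_V[OF b(1)] u'] by simp
      also have "\<dots> = L (k * u')" using b(2) EU'[OF kV u'] by simp
      also have "\<dots> = 0" using k u' by (simp add: trunc_hankel_kernel_def)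
      finally show "L (b * u') = 0" .
    qed
    then show "k \<in> hankel_ker \<tau>" using b(2) by (simp add: hankel_ker_def)
  qed
  then have "J \<subseteq> hankel_ker \<tau>"
    by (rule I.span_minimal)
       (auto intro!: I.subspaceI hankel_ker_add hankel_ker_times simp: hankel_ker_iff_star star_zero)
  then have "pairing \<tau> ((p - act p e) * 1) = 0"
    using minus_act_e[of p] unfolding hankel_ker_def by blast
  then have "pairing \<tau> p = pairing \<tau> (act p e)" by (simp add: pairing_diff)
  also have "\<dots> = L (act p e)"
    \<comment> \<open>The factor 1 from \<open>V'\<close> puts elements of \<open>E\<close> into the
      product space.\<close>
    using times_in_prod_space[OF E_V[OF act_in[OF e_in]] one_in_connected_to_1[OF V'_connected], of p]
    by (intro \<tau>) simp
  finally show ?thesis .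
qed

end

theorem theorem4:
  fixes V V' U U' :: "('v::finite, 'a::{alg_closed_field, field_char_0}) mpoly set"
    and \<sigma> :: "('v, 'a) mpoly \<Rightarrow> 'a"
    and r :: nat
  assumes "psubspace V" and "psubspace V'"
    and "connected_to_1 V" and "connected_to_1 V'"
    and "linear_form_on (prod_space V V') \<sigma>"
    and "psubspace U" and "psubspace U'" and "U \<subseteq> V" and "U' \<subseteq> V'"
    and "1 \<in> U" and "plus_space U \<subseteq> V" and "plus_space U' \<subseteq> V'"
    and "trunc_hankel_rank V V' \<sigma> r" and "trunc_hankel_rank U U' \<sigma> r"
  shows "\<exists>\<tau> :: ('v, 'a) mseries.
           ((\<forall>p\<in>prod_space V V'. pairing \<tau> p = \<sigma> p) \<and> hankel_rank \<tau> r) \<and>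
           (\<forall>\<tau>'. (\<forall>p\<in>prod_space V V'. pairing \<tau>' p = \<sigma> p) \<and> hankel_rank \<tau>' r \<longrightarrow> \<tau>' = \<tau>) \<and>
           (\<exists>(r'::nat) (\<omega> :: nat \<Rightarrow> ('v, 'a) mpoly) (\<xi> :: nat \<Rightarrow> 'v \<Rightarrow> 'a).
              \<tau> = (\<lambda>\<gamma>. \<Sum>i<r'. poly_times_series (\<omega> i) (exp_series (\<xi> i)) \<gamma>) \<and>
              r = (\<Sum>i<r'. mu (\<omega> i))) \<and>
           hankel_ker \<tau> = ideal_gen (trunc_hankel_kernel (plus_space U) U' \<sigma>)"
proof -
  obtain L where L_add: "\<And>p q. L (p + q) = L p + L q" and L_pscale: "\<And>c p. L (pscale c p) = c * L p"
    and L_\<sigma>: "\<And>p. p \<in> prod_space V V' \<Longrightarrow> L p = \<sigma> p"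
    by (rule linear_form_extends[OF subspace_prod_space assms(5)]) blast
  have L_\<sigma>': "\<sigma> (p * w) = L (p * w)" if "p \<in> V" "w \<in> V'" for p w
    using L_\<sigma> times_in_prod_space[OF that] by simp
  have image: "hankel_image W W' \<sigma> = hankel_image W W' L" if "W \<subseteq> V" "W' \<subseteq> V'" for W W'
    unfolding hankel_image_def using that by (intro image_cong) (auto simp: fun_eq_iff intro!: L_\<sigma>')
  have rank_V: "trunc_hankel_rank V V' L r" and rank_U: "trunc_hankel_rank U U' L r"
    using assms(8,9,13,14) by (simp_all add: trunc_hankel_rank_def image)
  have kernel: "trunc_hankel_kernel (plus_space U) U' \<sigma> = trunc_hankel_kernel (plus_space U) U' L"
    unfolding trunc_hankel_kernel_def using assms(9,11) L_\<sigma>' by (metis (no_types, lifting) subsetD)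
  obtain B where B: "finite B" "P.independent B" "B \<subseteq> U" "card B = r"
    and nondeg: "\<And>b. b \<in> P.span B \<Longrightarrow> (\<And>u'. u' \<in> U' \<Longrightarrow> L (b * u') = 0) \<Longrightarrow> b = 0"
    using hankel_image_nondegenerate_basis[OF L_add L_pscale rank_U] by metis
  \<comment> \<open>Equality of the two ranks enters here: \<open>B\<close> comes from
    \<open>U\<close> and \<open>U'\<close>, but its size is also the rank on \<open>V\<close> and
    \<open>V'\<close>, so representatives are valid against all of \<open>V'\<close>.\<close>
  have "\<exists>b\<in>P.span B. \<forall>v'\<in>V'. L (b * v') = L (p * v')" if "p \<in> V" for p
  proof (rule hankel_representative[OF L_add L_pscale rank_V B(2) _ B(4) _ that])
    show "B \<subseteq> V" using B(3) assms(8) by blast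
    show "b = 0" if "b \<in> P.span B" "\<And>t. t \<in> V' \<Longrightarrow> L (b * t) = 0" for b
      using that assms(9) by (intro nondeg) auto
  qed
  then obtain \<pi> where \<pi>: "\<And>p. p \<in> V \<Longrightarrow> \<pi> p \<in> P.span B"
      "\<And>p v'. p \<in> V \<Longrightarrow> v' \<in> V' \<Longrightarrow> L (\<pi> p * v') = L (p * v')" by metis
  interpret flat_extension V V' U U' B L \<pi>
    by unfold_locales (fact L_add L_pscale assms B nondeg \<pi>)+
  obtain \<tau> where \<tau>: "\<And>p. pairing \<tau> p = L (act p e)"
    using pairing_surj[of "\<lambda>p. L (act p e)"] by (auto simp: act_add act_pscale L_add L_pscale)
  have rank: "hankel_rank \<tau> r" using extension(2)[OF \<tau>] B(4) by simp
  show ?thesis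
  proof (intro exI[of _ \<tau>] conjI ballI allI impI)
    show "pairing \<tau> p = \<sigma> p" if "p \<in> prod_space V V'" for p
      using that by (simp add: \<tau> L_act_prod_space L_\<sigma>)
    show "hankel_rank \<tau> r" by (rule rank)
    show "\<tau>' = \<tau>" if "(\<forall>p\<in>prod_space V V'. pairing \<tau>' p = \<sigma> p) \<and> hankel_rank \<tau>' r" for \<tau>'
    proof (rule series_eqI)
      fix p
      have "pairing \<tau>' p = L (act p e)"
        using that B(4) L_\<sigma> by (intro extension_unique) auto
      then show "pairing \<tau>' p = pairing \<tau> p" by (simp add: \<tau>)
    qed
    show "\<exists>(r'::nat) \<omega> \<xi>. \<tau> = (\<lambda>\<gamma>. \<Sum>i<r'. exp_poly (\<omega> i) (\<xi> i) \<gamma>) \<and> r = (\<Sum>i<r'. mu (\<omega> i))"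
      by (rule hankel_rank_decomposition[OF rank])
    show "hankel_ker \<tau> = ideal_gen (trunc_hankel_kernel (plus_space U) U' \<sigma>)"
      unfolding kernel by (rule extension(1)[OF \<tau>])
  qed
qed

end
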